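(* Let $\alpha,\beta,\gamma,\delta,\kappa$ be positive integers with $0<\gamma+\delta\le\beta+\kappa$ and $\kappa\le\min(\alpha,\gamma)$. Then there is a $\mathbb{Z}_3\mathbb{Z}_9$-linear code $C$ of type $(\alpha,\beta;\gamma,\delta;\kappa)$ with $\mathrm{rank}(C)=r$ if and only if $$r\in\left\{\gamma+2\delta,\ldots,\min\left(\beta+\delta+\kappa,\ \gamma+\delta+\binom{\delta+1}{2}+\binom{\delta+2}{3}\right)\right\}.$$
   Context: A $\mathbb{Z}_3\mathbb{Z}_9$-additive code $\mathcal{C}$ is a subgroup of $\mathbb{Z}_3^\alpha\times\mathbb{Z}_9^\beta$. As an abelian group $\mathcal{C}\cong\mathbb{Z}_3^\gamma\times\mathbb{Z}_9^\delta$; if $\kappa$ is the $\mathbb{Z}_3$-dimension of the projection onto the first $\alpha$ coordinates of the subcode of codewords of order dividing $3$, then $\mathcal{C}$ has type $(\alpha,\beta;\gamma,\delta;\kappa)$. The Gray map $\phi:\mathbb{Z}_9\to\mathbb{Z}_3^3$ is $\phi(\theta)=\theta''(1,1,1)+\theta'(0,1,2)$ for $\theta=3\theta''+\theta'$, $\theta',\theta''\in\{0,1,2\}$, and $\Phi(\mathbf{x},\mathbf{y})=(\mathbf{x},\phi(y_1),\ldots,\phi(y_\beta))$. A $\mathbb{Z}_3\mathbb{Z}_9$-linear code of type $(\alpha,\beta;\gamma,\delta;\kappa)$ is $C=\Phi(\mathcal{C})$ for such a $\mathcal{C}$. $\mathrm{rank}(C)$ is the dimension over $\mathbb{Z}_3$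 of the linear span of $C$. *)

theory Defs
  imports Main
begin

definition Z3Z9_space :: "nat \<Rightarrow> nat \<Rightarrow> (int list \<times> int list) set" where
  "Z3Z9_space a b = {(x, y). length x = a \<and> length y = b \<and>
      set x \<subseteq> {0..2} \<and> set y \<subseteq> {0..8}}"

definition z39_add :: "int list \<times> int list \<Rightarrow> int list \<times> int list \<Rightarrow> int list \<times> int list" where
  "z39_add u v = (map2 (\<lambda>a b. (a + b) mod 3) (fst u) (fst v),
                  map2 (\<lambda>a b. (a + b) mod 9) (snd u) (snd v))"

definition z39_neg :: "int list \<times> int list \<Rightarrow> int list \<times> int list" where
  "z39_neg u = (map (\<lambda>a. (- a) mod 3) (fst u), map (\<lambda>a. (- a) mod 9) (snd u))"

definition z39_zero :: "nat \<Rightarrow> nat \<Rightarrow> int list \<times> int list" where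
  "z39_zero a b = (replicate a 0, replicate b 0)"

definition additive_code :: "nat \<Rightarrow> nat \<Rightarrow> (int list \<times> int list) set \<Rightarrow> bool" where
  "additive_code a b C \<longleftrightarrow> C \<subseteq> Z3Z9_space a b \<and> z39_zero a b \<in> C \<and>
     (\<forall>u\<in>C. \<forall>v\<in>C. z39_add u v \<in> C) \<and> (\<forall>u\<in>C. z39_neg u \<in> C)"

definition f3_add :: "int list \<Rightarrow> int list \<Rightarrow> int list" where
  "f3_add v w = map2 (\<lambda>a b. (a + b) mod 3) v w"

definition f3_smult :: "int \<Rightarrow> int list \<Rightarrow> int list" where
  "f3_smult c v = map (\<lambda>a. (c * a) mod 3) v"

inductive_set f3_span :: "nat \<Rightarrow> int list set \<Rightarrow> int list set" for n :: nat and S :: "int list set" where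
  zero: "replicate n 0 \<in> f3_span n S"
| comb: "v \<in> S \<Longrightarrow> c \<in> {0..2} \<Longrightarrow> w \<in> f3_span n S \<Longrightarrow> f3_add (f3_smult c v) w \<in> f3_span n S"

definition f3_dim :: "nat \<Rightarrow> int list set \<Rightarrow> nat" where
  "f3_dim n V = (LEAST k. \<exists>B. finite B \<and> card B = k \<and> B \<subseteq> V \<and> f3_span n B = V)"

definition code_type :: "nat \<Rightarrow> nat \<Rightarrow> nat \<Rightarrow> nat \<Rightarrow> nat \<Rightarrow> (int list \<times> int list) set \<Rightarrow> bool" where
  "code_type a b g d k C \<longleftrightarrow> additive_code a b C \<and>
     (\<exists>f. bij_betw f (Z3Z9_space g d) C \<and>
          (\<forall>u\<in>Z3Z9_space g d. \<forall>v\<in>Z3Z9_space g d. f (z39_add u v) = z39_add (f u) (f v))) \<and>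
     f3_dim a {x. \<exists>y. (x, y) \<in> C \<and> z39_add (x, y) (z39_add (x, y) (x, y)) = z39_zero a b} = k"

definition gray :: "int \<Rightarrow> int list" where
  "gray t = (let t2 = t div 3; t1 = t mod 3 in
             [t2 mod 3, (t2 + t1) mod 3, (t2 + 2 * t1) mod 3])"

definition Gray :: "int list \<times> int list \<Rightarrow> int list" where
  "Gray u = fst u @ concat (map gray (snd u))"

definition code_rank :: "nat \<Rightarrow> nat \<Rightarrow> (int list \<times> int list) set \<Rightarrow> nat" where
  "code_rank a b C = f3_dim (a + 3 * b) (f3_span (a + 3 * b) (Gray ` C))"

end

theory Submission
  imports Defs "HOL-Number_Theory.Cong" "HOL-Library.Multiset" "HOL-Library.FuncSet"
begin

text \<open>
  Up to invertible linear combinations, the Gray coordinates of a codeword are its ternary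
  coordinates together with the low and the high ternary digits of its \<open>\<int>\<^sub>9\<close>-coordinates, so the
  rank is the dimension of the space of functions modulo 3 of the parameters \<open>(x, \<mu>) \<in> \<int>\<^sub>3\<^sup>\<gamma> \<times> \<int>\<^sub>9\<^sup>\<delta>\<close>
  of the code that is spanned by these digits. Modulo 3, the third difference of the high digit
  \<open>s div 3\<close> is the trilinear form \<open>s t u\<close>, so its fourth difference vanishes, and the high digits of
  all sums of coordinates of \<open>\<mu>\<close> are spanned by those of the sums \<open>\<Sum>j\<in>#M. \<mu>\<^sub>j\<close> over multisets \<open>M\<close> of
  size 1, 2 or 3. Since the high digit of \<open>3 \<mu>\<^sub>j\<close> is the low digit of \<open>\<mu>\<^sub>j\<close>, these functions and the
  \<open>\<gamma>\<close> coordinates of \<open>x\<close> span all digits, whence one upper bound. The other one holds because there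
  are \<open>\<beta>\<close> high digits, while the remaining digits are spanned by the \<open>\<delta>\<close> low digits of \<open>\<mu>\<close> and
  \<open>\<kappa>\<close> linear functions of \<open>x\<close>. The lower bound is the injectivity of the Gray map.

  Third, second and first differences show that the functions indexed by the multisets are linearly
  independent. Hence appending forms \<open>\<Sum>j\<in>#M. \<mu>\<^sub>j\<close>, other than \<open>\<mu>\<^sub>j\<close> and \<open>3 \<mu>\<^sub>j\<close>, as
  \<open>\<int>\<^sub>9\<close>-coordinates to the trivial code of the given type raises the rank by exactly one each.
\<close>

subsection \<open>Vectors over the integers modulo \<open>q\<close>\<close>

definition zmod_vecs :: "int \<Rightarrow> nat \<Rightarrow> int list set" where
  "zmod_vecs q n = {v. length v = n \<and> set v \<subseteq> {0..<q}}"

definition zmod_add :: "int \<Rightarrow> int list \<Rightarrow> int list \<Rightarrow> int list" where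
  "zmod_add q v w = map2 (\<lambda>s t. (s + t) mod q) v w"

lemma zmod_vecs_iff_nth:
  "v \<in> zmod_vecs q n \<longleftrightarrow> length v = n \<and> (\<forall>i<n. 0 \<le> v ! i \<and> v ! i < q)"
  by (force simp: zmod_vecs_def set_conv_nth subset_iff)

lemma length_zmod_vecs: "v \<in> zmod_vecs q n \<Longrightarrow> length v = n"
  by (simp add: zmod_vecs_def)

lemma finite_zmod_vecs [simp]: "finite (zmod_vecs q n)"
  using finite_lists_length_eq[of "{0..<q}" n] by (simp add: zmod_vecs_def conj_commute)

lemma card_zmod_vecs: "card (zmod_vecs q n) = nat q ^ n"
  using card_lists_length_eq[of "{0..<q}" n] by (simp add: zmod_vecs_def conj_commute)

lemma Cons_in_zmod_vecs_iff:
  "s # v \<in> zmod_vecs q (Suc n) \<longleftrightarrow> 0 \<le> s \<and> s < q \<and> v \<in> zmod_vecs q n"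
  by (auto simp: zmod_vecs_def)

lemma append_in_zmod_vecs:
  "v \<in> zmod_vecs q m \<Longrightarrow> w \<in> zmod_vecs q n \<Longrightarrow> v @ w \<in> zmod_vecs q (m + n)"
  by (simp add: zmod_vecs_def)

lemma replicate_zero_in_zmod_vecs: "0 < q \<Longrightarrow> replicate n 0 \<in> zmod_vecs q n"
  by (simp add: zmod_vecs_iff_nth)

lemma length_zmod_add [simp]: "length (zmod_add q v w) = min (length v) (length w)"
  by (simp add: zmod_add_def)

lemma nth_zmod_add [simp]:
  "i < length v \<Longrightarrow> i < length w \<Longrightarrow> zmod_add q v w ! i = (v ! i + w ! i) mod q"
  by (simp add: zmod_add_def)

lemma zmod_add_Cons: "zmod_add q (s # v) (t # w) = ((s + t) mod q) # zmod_add q v w"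
  by (simp add: zmod_add_def)

lemma zmod_add_append:
  "length v = length v' \<Longrightarrow> zmod_add q (v @ w) (v' @ w') = zmod_add q v v' @ zmod_add q w w'"
  by (simp add: zmod_add_def)

lemma zmod_add_in_vecs:
  "v \<in> zmod_vecs q n \<Longrightarrow> w \<in> zmod_vecs q n \<Longrightarrow> zmod_add q v w \<in> zmod_vecs q n"
  by (auto simp: zmod_vecs_iff_nth intro: order.strict_trans1 pos_mod_bound pos_mod_sign)

lemma zmod_add_zero_left: "v \<in> zmod_vecs q n \<Longrightarrow> zmod_add q (replicate n 0) v = v"
  by (rule nth_equalityI) (auto simp: zmod_vecs_iff_nth)

subsection \<open>Dimension and cardinality over the field with three elements\<close>

abbreviation f3_vecs :: "nat \<Rightarrow> int list set" where
  "f3_vecs \<equiv> zmod_vecs 3"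

lemma f3_add_eq_zmod_add: "f3_add = zmod_add 3"
  by (simp add: fun_eq_iff f3_add_def zmod_add_def)

lemma length_f3_add [simp]: "length (f3_add v w) = min (length v) (length w)"
  and nth_f3_add [simp]:
    "i < length v \<Longrightarrow> i < length w \<Longrightarrow> f3_add v w ! i = (v ! i + w ! i) mod 3"
  by (simp_all add: f3_add_eq_zmod_add)

lemma length_f3_smult [simp]: "length (f3_smult c v) = length v"
  and nth_f3_smult [simp]: "i < length v \<Longrightarrow> f3_smult c v ! i = (c * v ! i) mod 3"
  by (simp_all add: f3_smult_def)

lemma f3_add_in_vecs: "v \<in> f3_vecs n \<Longrightarrow> w \<in> f3_vecs n \<Longrightarrow> f3_add v w \<in> f3_vecs n"
  by (simp add: f3_add_eq_zmod_add zmod_add_in_vecs)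

lemma f3_add_zero_left: "v \<in> f3_vecs n \<Longrightarrow> f3_add (replicate n 0) v = v"
  by (simp add: f3_add_eq_zmod_add zmod_add_zero_left)

lemma f3_smult_in_vecs: "v \<in> f3_vecs n \<Longrightarrow> f3_smult c v \<in> f3_vecs n"
  by (simp add: zmod_vecs_iff_nth)

lemma f3_add_assoc: "f3_add (f3_add u v) w = f3_add u (f3_add v w)"
  by (rule nth_equalityI) (auto simp: mod_simps add.assoc)

lemma f3_add_left_commute: "f3_add u (f3_add v w) = f3_add v (f3_add u w)"
  by (rule nth_equalityI) (auto simp: mod_simps add.left_commute)

lemma f3_smult_zero: "v \<in> f3_vecs n \<Longrightarrow> f3_smult 0 v = replicate n 0"
  by (rule nth_equalityI) (auto simp: zmod_vecs_iff_nth)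

lemma f3_smult_mod: "f3_smult (c mod 3) v = f3_smult c v"
  by (rule nth_equalityI) (auto simp: mod_simps)

lemma f3_smult_one: "v \<in> f3_vecs n \<Longrightarrow> f3_smult 1 v = v"
  by (rule nth_equalityI) (auto simp: zmod_vecs_iff_nth)

lemma f3_smult_add: "f3_smult (c + c') v = f3_add (f3_smult c v) (f3_smult c' v)"
  by (rule nth_equalityI) (auto simp: mod_simps distrib_right)

lemma f3_smult_smult: "f3_smult c (f3_smult c' v) = f3_smult (c * c') v"
  by (rule nth_equalityI) (auto simp: mod_simps mult.assoc)

definition f3_subspace :: "nat \<Rightarrow> int list set \<Rightarrow> bool" where
  "f3_subspace n V \<longleftrightarrow> V \<subseteq> f3_vecs n \<and> replicate n 0 \<in> V \<and> (\<forall>v\<in>V. \<forall>w\<in>V. f3_add v w \<in> V)"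

lemma f3_subspaceD:
  assumes "f3_subspace n V"
  shows "V \<subseteq> f3_vecs n" "replicate n 0 \<in> V" "\<And>v w. v \<in> V \<Longrightarrow> w \<in> V \<Longrightarrow> f3_add v w \<in> V"
  using assms by (auto simp: f3_subspace_def)

lemma finite_f3_subspace: "f3_subspace n V \<Longrightarrow> finite V"
  by (rule finite_subset[OF f3_subspaceD(1) finite_zmod_vecs])

lemma f3_subspace_vecs: "f3_subspace n (f3_vecs n)"
  by (simp add: f3_subspace_def f3_add_in_vecs replicate_zero_in_zmod_vecs)

lemma f3_subspace_smult:
  assumes V: "f3_subspace n V" and v: "v \<in> V"
  shows "f3_smult c v \<in> V"
proof -
  have "f3_smult (int m) v \<in> V" for m
  proof (induction m)
    case 0
    then show ?case
      using f3_subspaceD(1,2)[OF V] v by (auto simp: f3_smult_zero)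
  next
    case (Suc m)
    have "f3_smult 1 v = v"
      using f3_subspaceD(1)[OF V] v by (intro f3_smult_one) auto
    then show ?case
      using Suc f3_subspaceD(3)[OF V v] by (simp add: f3_smult_add)
  qed
  from this[of "nat (c mod 3)"] show ?thesis
    by (simp add: f3_smult_mod)
qed

lemma f3_span_subset:
  assumes V: "f3_subspace n V" and "S \<subseteq> V"
  shows "f3_span n S \<subseteq> V"
proof
  fix v assume "v \<in> f3_span n S"
  then show "v \<in> V"
    using assms(2) by induction (auto intro: f3_subspaceD[OF V] f3_subspace_smult[OF V])
qed

lemma f3_subspace_span:
  assumes "S \<subseteq> f3_vecs n"
  shows "f3_subspace n (f3_span n S)"
proof -
  have span: "f3_span n S \<subseteq> f3_vecs n"
    by (rule f3_span_subset[OF f3_subspace_vecs assms])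
  have "f3_add v w \<in> f3_span n S" if "v \<in> f3_span n S" and w: "w \<in> f3_span n S" for v w
    using that(1)
  proof induction
    case zero
    then show ?case
      using w span by (auto simp: f3_add_zero_left)
  next
    case (comb v c u)
    then show ?case
      by (simp add: f3_add_assoc f3_span.comb)
  qed
  then show ?thesis
    using span by (simp add: f3_subspace_def f3_span.zero)
qed

lemma f3_span_superset:
  assumes "S \<subseteq> f3_vecs n"
  shows "S \<subseteq> f3_span n S"
proof
  fix v assume v: "v \<in> S"
  then have "f3_add (f3_smult 1 v) (replicate n 0) = v"
    using assms by (intro nth_equalityI) (auto simp: zmod_vecs_iff_nth subset_iff)
  then show "v \<in> f3_span n S"
    using f3_span.comb[OF v, of 1 "replicate n 0" n] by (simp add: f3_span.zero)
qed

lemma f3_span_mono: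
  assumes "S \<subseteq> T" "T \<subseteq> f3_vecs n"
  shows "f3_span n S \<subseteq> f3_span n T"
  using assms f3_span_superset[OF assms(2)] by (intro f3_span_subset f3_subspace_span) auto

lemma f3_span_insert_absorb:
  assumes S: "S \<subseteq> f3_vecs n" and v: "v \<in> f3_span n S"
  shows "f3_span n (insert v S) = f3_span n S"
proof (rule antisym)
  note V = f3_subspace_span[OF S]
  show "f3_span n (insert v S) \<subseteq> f3_span n S"
    using v f3_span_superset[OF S] by (intro f3_span_subset[OF V]) simp
  have "insert v S \<subseteq> f3_vecs n"
    using S v f3_subspaceD(1)[OF V] by auto
  then show "f3_span n S \<subseteq> f3_span n (insert v S)"
    by (rule f3_span_mono[OF subset_insertI])
qed

lemma f3_span_subspace_eq: "f3_subspace n V \<Longrightarrow> f3_span n V = V"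
  by (simp add: antisym f3_span_subset f3_span_superset f3_subspaceD(1))

lemma f3_span_empty: "f3_span n {} = {replicate n 0}"
proof (rule antisym)
  show "f3_span n {} \<subseteq> {replicate n 0}"
    by (rule f3_span_subset)
      (auto simp: f3_subspace_def replicate_zero_in_zmod_vecs f3_add_zero_left)
qed (simp add: f3_span.zero)

definition f3_add_line :: "int list \<Rightarrow> int list set \<Rightarrow> int list set" where
  "f3_add_line v W = {f3_add (f3_smult c v) w | c w. w \<in> W}"

lemma f3_add_in_line: "w \<in> W \<Longrightarrow> f3_add (f3_smult c v) w \<in> f3_add_line v W"
  by (auto simp: f3_add_line_def)

lemma f3_add_line_eq_image:
  "f3_add_line v W = (\<lambda>(c, w). f3_add (f3_smult c v) w) ` ({0..2} \<times> W)"
proof (intro equalityI subsetI)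
  fix u assume "u \<in> f3_add_line v W"
  then obtain c w where "w \<in> W" "u = f3_add (f3_smult (c mod 3) v) w"
    by (auto simp: f3_add_line_def f3_smult_mod)
  moreover have "c mod 3 \<in> {0..2}"
    using pos_mod_bound[of 3 c] by (simp del: pos_mod_bound)
  ultimately show "u \<in> (\<lambda>(c, w). f3_add (f3_smult c v) w) ` ({0..2} \<times> W)"
    by (intro image_eqI[of _ _ "(c mod 3, w)"]) simp_all
qed (auto simp: f3_add_line_def)

lemma f3_subspace_add_line:
  assumes W: "f3_subspace n W" and v: "v \<in> f3_vecs n"
  shows "f3_subspace n (f3_add_line v W)"
  unfolding f3_subspace_def
proof (intro conjI ballI)
  show "f3_add_line v W \<subseteq> f3_vecs n"
    using f3_subspaceD(1)[OF W] v
    by (auto simp: f3_add_line_def intro!: f3_add_in_vecs f3_smult_in_vecs)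
  have "f3_add (f3_smult 0 v) (replicate n 0) = replicate n 0"
    using v by (simp add: f3_smult_zero f3_add_zero_left replicate_zero_in_zmod_vecs)
  then show "replicate n 0 \<in> f3_add_line v W"
    using f3_add_in_line f3_subspaceD(2)[OF W] by metis
  fix x y assume "x \<in> f3_add_line v W" "y \<in> f3_add_line v W"
  then obtain c w c' w' where "x = f3_add (f3_smult c v) w" "y = f3_add (f3_smult c' v) w'"
    and w: "w \<in> W" "w' \<in> W"
    by (auto simp: f3_add_line_def)
  then have "f3_add x y = f3_add (f3_smult (c + c') v) (f3_add w w')"
    by (simp add: f3_smult_add f3_add_assoc f3_add_left_commute[of w])
  then show "f3_add x y \<in> f3_add_line v W"
    by (simp add: f3_add_in_line f3_subspaceD(3)[OF W w])
qed

lemma f3_span_insert: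
  assumes "insert v S \<subseteq> f3_vecs n"
  shows "f3_span n (insert v S) = f3_add_line v (f3_span n S)"
proof (rule antisym)
  have v: "v \<in> f3_vecs n" and S: "S \<subseteq> f3_vecs n"
    using assms by auto
  have "f3_add (f3_smult 1 v) (replicate n 0) = v"
    using v by (intro nth_equalityI) (auto simp: zmod_vecs_iff_nth)
  then have "v \<in> f3_add_line v (f3_span n S)"
    using f3_add_in_line f3_span.zero by metis
  moreover have "S \<subseteq> f3_add_line v (f3_span n S)"
  proof
    fix w assume "w \<in> S"
    then have "w \<in> f3_span n S" "f3_add (f3_smult 0 v) w = w"
      using S v f3_span_superset[OF S] by (auto simp: f3_smult_zero f3_add_zero_left)
    then show "w \<in> f3_add_line v (f3_span n S)"
      using f3_add_in_line by metis
  qed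
  ultimately show "f3_span n (insert v S) \<subseteq> f3_add_line v (f3_span n S)"
    by (intro f3_span_subset f3_subspace_add_line f3_subspace_span S v) simp
  have "f3_span n S \<subseteq> f3_span n (insert v S)"
    by (rule f3_span_mono[OF subset_insertI assms])
  then show "f3_add_line v (f3_span n S) \<subseteq> f3_span n (insert v S)"
    by (auto simp: f3_add_line_eq_image intro: f3_span.comb)
qed

lemma f3_smult_in_subspace_cancel:
  assumes W: "f3_subspace n W" and v: "v \<in> f3_vecs n"
    and cv: "f3_smult c v \<in> W" and c: "\<not> 3 dvd c"
  shows "v \<in> W"
proof -
  have "c mod 3 = 1 \<or> c mod 3 = 2"
    using c by presburger
  then have "(c * c) mod 3 = 1"
    by (auto simp: mod_mult_eq[of c 3 c, symmetric])
  then have "f3_smult c (f3_smult c v) = v"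
    using f3_smult_mod[of "c * c" v] f3_smult_one[OF v] by (simp add: f3_smult_smult)
  then show ?thesis
    using f3_subspace_smult[OF W cv, of c] by simp
qed

lemma f3_add_line_inj:
  assumes W: "f3_subspace n W" and v: "v \<in> f3_vecs n" "v \<notin> W" and w: "w \<in> W" "w' \<in> W"
    and eq: "f3_add (f3_smult c v) w = f3_add (f3_smult c' v) w'"
  shows "3 dvd c - c'" "w = w'"
proof -
  have w_vecs: "w \<in> f3_vecs n" "w' \<in> f3_vecs n"
    using w f3_subspaceD(1)[OF W] by auto
  have "f3_add (f3_smult (c - c') v) w = f3_add (f3_smult (- c') v) (f3_add (f3_smult c v) w)"
    using f3_smult_add[of "- c'" c v] by (simp add: f3_add_assoc)
  also have "\<dots> = f3_add (f3_smult (- c' + c') v) w'"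
    by (simp only: eq f3_smult_add f3_add_assoc)
  also have "\<dots> = w'"
    using v w_vecs by (simp add: f3_smult_zero f3_add_zero_left)
  finally have w': "f3_add (f3_smult (c - c') v) w = w'" .
  then have "f3_smult (c - c') v = f3_add w' (f3_smult (- 1) w)"
    using v w_vecs by (intro nth_equalityI) (auto simp: zmod_vecs_iff_nth mod_simps)
  then have "f3_smult (c - c') v \<in> W"
    using w by (simp add: f3_subspaceD(3)[OF W] f3_subspace_smult[OF W])
  then show "3 dvd c - c'"
    using f3_smult_in_subspace_cancel[OF W v(1)] v(2) by blast
  then have "f3_smult (c - c') v = replicate n 0"
    using f3_smult_mod[of "c - c'" v] v by (simp add: f3_smult_zero mod_eq_0_iff_dvd)
  then show "w = w'"
    using w' w_vecs by (simp add: f3_add_zero_left)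
qed

lemma card_f3_add_line:
  assumes "f3_subspace n W" "v \<in> f3_vecs n" "v \<notin> W"
  shows "card (f3_add_line v W) = 3 * card W"
proof -
  have "inj_on (\<lambda>(c, w). f3_add (f3_smult c v) w) ({0..2} \<times> W)"
  proof (rule inj_onI, clarify)
    fix c c' :: int and w w'
    assume "c \<in> {0..2}" "c' \<in> {0..2}" and w: "w \<in> W" "w' \<in> W"
      and eq: "f3_add (f3_smult c v) w = f3_add (f3_smult c' v) w'"
    then show "c = c' \<and> w = w'"
      using f3_add_line_inj[OF assms w eq] unfolding atLeastAtMost_iff by presburger
  qed
  then show ?thesis
    by (simp add: f3_add_line_eq_image card_image card_cartesian_product)
qed

lemma card_f3_add_line_le:
  assumes "finite W"
  shows "card (f3_add_line v W) \<le> 3 * card W"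
  unfolding f3_add_line_eq_image
  using card_image_le[of "{0..2} \<times> W" "\<lambda>(c, w). f3_add (f3_smult c v) w"] assms
  by (simp add: card_cartesian_product)

lemma card_f3_span_le:
  assumes "finite S" "S \<subseteq> f3_vecs n"
  shows "card (f3_span n S) \<le> 3 ^ card S"
  using assms
proof (induction S)
  case empty
  then show ?case
    by (simp add: f3_span_empty)
next
  case (insert v S)
  have "finite (f3_span n S)"
    using insert.prems by (intro finite_f3_subspace[OF f3_subspace_span]) auto
  then have "card (f3_span n (insert v S)) \<le> 3 * card (f3_span n S)"
    unfolding f3_span_insert[OF insert.prems] by (rule card_f3_add_line_le)
  then show ?case
    using insert by simp
qed

lemma f3_basis_exists:
  assumes "finite S" "S \<subseteq> f3_vecs n"
  shows "\<exists>B\<subseteq>S. f3_span n B = f3_span n S \<and> card (f3_span n S) = 3 ^ card B"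
  using assms
proof (induction S)
  case empty
  then show ?case
    by (simp add: f3_span_empty)
next
  case (insert v S)
  then obtain B where B: "B \<subseteq> S" "f3_span n B = f3_span n S" "card (f3_span n S) = 3 ^ card B"
    by auto
  have vB: "insert v B \<subseteq> f3_vecs n"
    using B insert.prems by auto
  have span_eq: "f3_span n (insert v B) = f3_span n (insert v S)"
    using vB insert.prems B by (simp add: f3_span_insert)
  show ?case
  proof (cases "v \<in> f3_span n B")
    case True
    then have "f3_span n (insert v S) = f3_span n B"
      using vB f3_span_insert_absorb[of B n v] by (simp flip: span_eq)
    then show ?thesis
      using B by auto
  next
    case False
    then have "v \<notin> B"
      using f3_span_superset[of B n] vB by auto
    moreover have "finite B"
      using B(1) insert.hyps(1) by (rule finite_subset)
    moreover have "card (f3_span n (insert v S)) = 3 * card (f3_span n B)"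
      unfolding span_eq[symmetric] f3_span_insert[OF vB]
      using vB False by (intro card_f3_add_line[OF f3_subspace_span]) auto
    ultimately have "card (f3_span n (insert v S)) = 3 ^ card (insert v B)"
      using B by simp
    then show ?thesis
      using B(1) span_eq by (intro exI[of _ "insert v B"]) auto
  qed
qed

lemma f3_dim_basis:
  assumes V: "f3_subspace n V"
  obtains B where "B \<subseteq> V" "f3_span n B = V" "card B = f3_dim n V" "card V = 3 ^ f3_dim n V"
proof -
  obtain B where B: "B \<subseteq> V" "f3_span n B = V" "card V = 3 ^ card B"
    using f3_basis_exists[OF finite_f3_subspace[OF V] f3_subspaceD(1)[OF V]]
    by (auto simp: f3_span_subspace_eq[OF V])
  have "f3_dim n V = card B"
    unfolding f3_dim_def
  proof (rule Least_equality)
    show "\<exists>B'. finite B' \<and> card B' = card B \<and> B' \<subseteq> V \<and> f3_span n B' = V"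
      using B finite_subset[OF _ finite_f3_subspace[OF V]] by blast
    fix m assume "\<exists>B'. finite B' \<and> card B' = m \<and> B' \<subseteq> V \<and> f3_span n B' = V"
    then obtain B' where "finite B'" "card B' = m" "B' \<subseteq> V" "f3_span n B' = V"
      by blast
    then have "card V \<le> 3 ^ m"
      using card_f3_span_le[of B' n] f3_subspaceD(1)[OF V] by auto
    then show "card B \<le> m"
      using B by simp
  qed
  with B show ?thesis
    using that by simp
qed

lemma card_f3_subspace:
  assumes "f3_subspace n V"
  shows "card V = 3 ^ f3_dim n V"
  using f3_dim_basis[OF assms] by blast

lemma f3_dim_mono:
  assumes "f3_subspace n V" "f3_subspace n W" "V \<subseteq> W"
  shows "f3_dim n V \<le> f3_dim n W"
proof -
  have "card V \<le> card W"
    by (rule card_mono[OF finite_f3_subspace[OF assms(2)] assms(3)])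
  then show ?thesis
    using assms by (simp add: card_f3_subspace)
qed

lemma f3_subspace_hyperplane:
  "f3_subspace n {v \<in> f3_vecs n. 3 dvd (\<Sum>j<n. s j * v ! j)}"
  unfolding f3_subspace_def
proof (intro conjI ballI)
  let ?K = "{v \<in> f3_vecs n. 3 dvd (\<Sum>j<n. s j * v ! j)}"
  fix v w assume vw: "v \<in> ?K" "w \<in> ?K"
  have "[(\<Sum>j<n. s j * f3_add v w ! j) = (\<Sum>j<n. s j * (v ! j + w ! j))] (mod 3)"
    using vw by (intro cong_sum cong_scalar_left) (auto simp: zmod_vecs_iff_nth cong_def)
  then show "f3_add v w \<in> ?K"
    using vw by (simp add: f3_add_in_vecs cong_dvd_iff distrib_left sum.distrib)
qed (auto simp: replicate_zero_in_zmod_vecs)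

lemma f3_annihilator_exists:
  assumes V: "f3_subspace n V" and dim: "f3_dim n V < n"
  obtains s :: "nat \<Rightarrow> int" and i where
    "\<And>v. v \<in> V \<Longrightarrow> 3 dvd (\<Sum>j<n. s j * v ! j)" "i < n" "\<not> 3 dvd s i"
proof -
  obtain B where B: "B \<subseteq> V" "f3_span n B = V" "card B = f3_dim n V"
    using f3_dim_basis[OF V] by blast
  have finB: "finite B"
    by (rule finite_subset[OF B(1) finite_f3_subspace[OF V]])
  define ev where "ev = (\<lambda>c. \<lambda>w\<in>B. (\<Sum>j<n. c ! j * w ! j) mod (3::int))"
  have "card (ev ` f3_vecs n) \<le> card (B \<rightarrow>\<^sub>E {0..<3::int})"
    using finB by (intro card_mono finite_PiE) (auto simp: ev_def)
  also have "\<dots> < card (f3_vecs n)"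
    using dim finB B(3) by (simp add: card_zmod_vecs card_PiE)
  finally have "\<not> inj_on ev (f3_vecs n)"
    by (rule pigeonhole)
  then obtain c c' where c: "c \<in> f3_vecs n" "c' \<in> f3_vecs n" "c \<noteq> c'" and ev: "ev c = ev c'"
    by (auto simp: inj_on_def)
  then obtain i where i: "i < n" "c ! i \<noteq> c' ! i"
    by (metis length_zmod_vecs nth_equalityI)
  have "f3_span n B \<subseteq> {v \<in> f3_vecs n. 3 dvd (\<Sum>j<n. (c ! j - c' ! j) * v ! j)}"
  proof (rule f3_span_subset[OF f3_subspace_hyperplane], rule subsetI)
    fix w assume w: "w \<in> B"
    have "[(\<Sum>j<n. c ! j * w ! j) = (\<Sum>j<n. c' ! j * w ! j)] (mod 3)"
      using fun_cong[OF ev, of w] w by (simp add: ev_def cong_def)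
    then show "w \<in> {v \<in> f3_vecs n. 3 dvd (\<Sum>j<n. (c ! j - c' ! j) * v ! j)}"
      using w B(1) f3_subspaceD(1)[OF V]
      by (auto simp: cong_iff_dvd_diff left_diff_distrib sum_subtractf)
  qed
  then have "3 dvd (\<Sum>j<n. (c ! j - c' ! j) * v ! j)" if "v \<in> V" for v
    using that B(2) by auto
  moreover have "\<not> 3 dvd c ! i - c' ! i"
  proof -
    have "0 \<le> c ! i" "c ! i < 3" "0 \<le> c' ! i" "c' ! i < 3"
      using c i(1) by (auto simp: zmod_vecs_iff_nth)
    then show ?thesis
      using i(2) by presburger
  qed
  ultimately show ?thesis
    using i(1) by (intro that[of "\<lambda>j. c ! j - c' ! j" i])
qed

definition f3_mat_vec :: "nat \<Rightarrow> nat \<Rightarrow> (nat \<Rightarrow> nat \<Rightarrow> int) \<Rightarrow> int list \<Rightarrow> int list" where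
  "f3_mat_vec m n s v = map (\<lambda>i. (\<Sum>j<n. s i j * v ! j) mod 3) [0..<m]"

lemma f3_mat_vec_add:
  assumes "length v = n" "length w = n"
  shows "f3_mat_vec m n s (f3_add v w) = f3_add (f3_mat_vec m n s v) (f3_mat_vec m n s w)"
proof (rule nth_equalityI)
  fix i assume "i < length (f3_mat_vec m n s (f3_add v w))"
  then have i: "i < m"
    by (simp add: f3_mat_vec_def)
  have "[(\<Sum>j<n. s i j * f3_add v w ! j) = (\<Sum>j<n. s i j * (v ! j + w ! j))] (mod 3)"
    using assms by (intro cong_sum cong_scalar_left) (auto simp: cong_def)
  then show "f3_mat_vec m n s (f3_add v w) ! i
      = f3_add (f3_mat_vec m n s v) (f3_mat_vec m n s w) ! i"
    using i by (simp add: f3_mat_vec_def cong_def mod_simps distrib_left sum.distrib)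
qed (simp add: f3_mat_vec_def)

lemma f3_subspace_mat_vec_image:
  assumes V: "f3_subspace n V"
  shows "f3_subspace m (f3_mat_vec m n s ` V)"
  unfolding f3_subspace_def
proof (intro conjI ballI)
  show "f3_mat_vec m n s ` V \<subseteq> f3_vecs m"
    by (auto simp: f3_mat_vec_def zmod_vecs_iff_nth)
  have "f3_mat_vec m n s (replicate n 0) = replicate m 0"
    by (rule nth_equalityI) (simp_all add: f3_mat_vec_def)
  then show "replicate m 0 \<in> f3_mat_vec m n s ` V"
    using f3_subspaceD(2)[OF V] by (metis imageI)
  fix x y assume "x \<in> f3_mat_vec m n s ` V" "y \<in> f3_mat_vec m n s ` V"
  then obtain v w where "v \<in> V" "w \<in> V" "x = f3_mat_vec m n s v" "y = f3_mat_vec m n s w"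
    by auto
  moreover from this have "length v = n" "length w = n"
    using f3_subspaceD(1)[OF V] by (auto simp: length_zmod_vecs)
  ultimately show "f3_add x y \<in> f3_mat_vec m n s ` V"
    using f3_subspaceD(3)[OF V] by (metis f3_mat_vec_add imageI)
qed

lemma f3_dim_mat_vec_image_le:
  assumes V: "f3_subspace n V"
  shows "f3_dim m (f3_mat_vec m n s ` V) \<le> f3_dim n V"
proof -
  have "card (f3_mat_vec m n s ` V) \<le> card V"
    by (intro card_image_le finite_f3_subspace[OF V])
  then show ?thesis
    by (simp add: card_f3_subspace[OF V] card_f3_subspace[OF f3_subspace_mat_vec_image[OF V]])
qed

lemma f3_subspace_append:
  assumes V: "f3_subspace m V" and W: "f3_subspace n W"
  shows "f3_subspace (m + n) ((\<lambda>(v, w). v @ w) ` (V \<times> W))"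
  unfolding f3_subspace_def
proof (intro conjI ballI)
  show "(\<lambda>(v, w). v @ w) ` (V \<times> W) \<subseteq> f3_vecs (m + n)"
    using f3_subspaceD(1)[OF V] f3_subspaceD(1)[OF W] by (auto intro!: append_in_zmod_vecs)
  show "replicate (m + n) 0 \<in> (\<lambda>(v, w). v @ w) ` (V \<times> W)"
    using f3_subspaceD(2)[OF V] f3_subspaceD(2)[OF W] by (auto simp: replicate_add)
  fix x y assume "x \<in> (\<lambda>(v, w). v @ w) ` (V \<times> W)" "y \<in> (\<lambda>(v, w). v @ w) ` (V \<times> W)"
  then obtain v w v' w' where x: "x = v @ w" "v \<in> V" "w \<in> W" and y: "y = v' @ w'" "v' \<in> V" "w' \<in> W"
    by auto
  then have "length v = length v'"
    using f3_subspaceD(1)[OF V] by (metis length_zmod_vecs subsetD)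
  then have "f3_add x y = f3_add v v' @ f3_add w w'"
    by (simp add: x y f3_add_eq_zmod_add zmod_add_append)
  then show "f3_add x y \<in> (\<lambda>(v, w). v @ w) ` (V \<times> W)"
    using x y f3_subspaceD(3)[OF V] f3_subspaceD(3)[OF W] by auto
qed

lemma f3_dim_append_le:
  assumes V: "f3_subspace m V" and W: "f3_subspace n W"
  shows "f3_dim (m + n) ((\<lambda>(v, w). v @ w) ` (V \<times> W)) \<le> f3_dim m V + f3_dim n W"
proof -
  have "card ((\<lambda>(v, w). v @ w) ` (V \<times> W)) \<le> card (V \<times> W)"
    using V W by (intro card_image_le) (simp add: finite_f3_subspace)
  then have "(3::nat) ^ f3_dim (m + n) ((\<lambda>(v, w). v @ w) ` (V \<times> W)) \<le> 3 ^ (f3_dim m V + f3_dim n W)"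
    using V W card_f3_subspace[OF f3_subspace_append[OF V W]]
    by (simp add: card_f3_subspace card_cartesian_product power_add)
  then show ?thesis
    by simp
qed

lemma f3_dim_vecs: "f3_dim n (f3_vecs n) = n"
  using card_f3_subspace[OF f3_subspace_vecs, of n] by (simp add: card_zmod_vecs)

subsection \<open>Ranks of families of functions modulo 3\<close>

inductive_set f3_fun_span :: "'p set \<Rightarrow> ('p \<Rightarrow> int) set \<Rightarrow> ('p \<Rightarrow> int) set"
  for X :: "'p set" and E :: "('p \<Rightarrow> int) set" where
  zero: "(\<lambda>_. 0) \<in> f3_fun_span X E"
| base: "e \<in> E \<Longrightarrow> e \<in> f3_fun_span X E"
| add: "h \<in> f3_fun_span X E \<Longrightarrow> h' \<in> f3_fun_span X E \<Longrightarrow> (\<lambda>p. h p + h' p) \<in> f3_fun_span X E"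
| scale: "h \<in> f3_fun_span X E \<Longrightarrow> (\<lambda>p. c * h p) \<in> f3_fun_span X E"
| cong: "h \<in> f3_fun_span X E \<Longrightarrow> (\<And>p. p \<in> X \<Longrightarrow> [h' p = h p] (mod 3)) \<Longrightarrow> h' \<in> f3_fun_span X E"

lemma f3_fun_span_minus: "h \<in> f3_fun_span X E \<Longrightarrow> (\<lambda>p. - h p) \<in> f3_fun_span X E"
  using f3_fun_span.scale[of h X E "- 1"] by simp

lemma f3_fun_span_diff:
  "h \<in> f3_fun_span X E \<Longrightarrow> h' \<in> f3_fun_span X E \<Longrightarrow> (\<lambda>p. h p - h' p) \<in> f3_fun_span X E"
  using f3_fun_span.add[OF _ f3_fun_span_minus, of h X E h'] by simp

lemma f3_fun_span_sum:
  "(\<And>j. j \<in> J \<Longrightarrow> h j \<in> f3_fun_span X E) \<Longrightarrow> (\<lambda>p. \<Sum>j\<in>J. h j p) \<in> f3_fun_span X E"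
  by (induction J rule: infinite_finite_induct) (auto intro: f3_fun_span.zero f3_fun_span.add)

lemma f3_fun_span_trans:
  "h \<in> f3_fun_span X E \<Longrightarrow> E \<subseteq> f3_fun_span X E' \<Longrightarrow> h \<in> f3_fun_span X E'"
  by (induction rule: f3_fun_span.induct)
    (auto intro: f3_fun_span.zero f3_fun_span.add f3_fun_span.scale f3_fun_span.cong)

lemma f3_fun_span_mono: "E \<subseteq> E' \<Longrightarrow> f3_fun_span X E \<subseteq> f3_fun_span X E'"
  by (auto intro: f3_fun_span_trans f3_fun_span.base)

lemma f3_fun_span_coeffs:
  assumes "h \<in> f3_fun_span X (set es)"
  shows "\<exists>s. \<forall>p\<in>X. [h p = (\<Sum>i<length es. s i * (es ! i) p)] (mod 3)"
  using assms
proof induction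
  case zero
  show ?case
    by (rule exI[of _ "\<lambda>_. 0"]) simp
next
  case (base e)
  then obtain j where "j < length es" "e = es ! j"
    by (metis in_set_conv_nth)
  then have "e p = (\<Sum>i<length es. of_bool (i = j) * (es ! i) p)" for p
    by (simp add: of_bool_def if_distrib if_distribR cong: if_cong)
  then show ?case
    by (intro exI[of _ "\<lambda>i. of_bool (i = j)"]) simp
next
  case (add h h')
  from add.IH obtain s s' where "\<forall>p\<in>X. [h p = (\<Sum>i<length es. s i * (es ! i) p)] (mod 3)"
    "\<forall>p\<in>X. [h' p = (\<Sum>i<length es. s' i * (es ! i) p)] (mod 3)"
    by blast
  then show ?case
    by (intro exI[of _ "\<lambda>i. s i + s' i"]) (simp add: distrib_right sum.distrib cong_add)
next
  case (scale h c)
  from scale.IH obtain s where "\<forall>p\<in>X. [h p = (\<Sum>i<length es. s i * (es ! i) p)] (mod 3)"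
    by blast
  then have "\<forall>p\<in>X. [c * h p = c * (\<Sum>i<length es. s i * (es ! i) p)] (mod 3)"
    by (simp add: cong_scalar_left)
  then show ?case
    by (intro exI[of _ "\<lambda>i. c * s i"]) (simp add: sum_distrib_left mult.assoc)
next
  case (cong h h')
  from cong.IH obtain s where "\<forall>p\<in>X. [h p = (\<Sum>i<length es. s i * (es ! i) p)] (mod 3)"
    by blast
  then have "[h' p = (\<Sum>i<length es. s i * (es ! i) p)] (mod 3)" if "p \<in> X" for p
    using cong_trans[OF cong.hyps(2)[OF that]] that by simp
  then show ?case
    by blast
qed

definition f3_fun_vec :: "('p \<Rightarrow> int) list \<Rightarrow> 'p \<Rightarrow> int list" where
  "f3_fun_vec es p = map (\<lambda>e. e p mod 3) es"

definition f3_fun_rank :: "'p set \<Rightarrow> ('p \<Rightarrow> int) list \<Rightarrow> nat" where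
  "f3_fun_rank X es = f3_dim (length es) (f3_span (length es) (f3_fun_vec es ` X))"

lemma f3_fun_vec_in_vecs: "f3_fun_vec es p \<in> f3_vecs (length es)"
  by (simp add: f3_fun_vec_def zmod_vecs_iff_nth)

lemma f3_fun_vec_append: "f3_fun_vec (es @ hs) p = f3_fun_vec es p @ f3_fun_vec hs p"
  by (simp add: f3_fun_vec_def)

lemma f3_subspace_span_fun_vec: "f3_subspace (length es) (f3_span (length es) (f3_fun_vec es ` X))"
  by (intro f3_subspace_span image_subsetI f3_fun_vec_in_vecs)

lemma f3_fun_vec_in_span: "p \<in> X \<Longrightarrow> f3_fun_vec es p \<in> f3_span (length es) (f3_fun_vec es ` X)"
  by (rule subsetD[OF f3_span_superset]) (auto simp: f3_fun_vec_in_vecs)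

lemma f3_fun_rank_le_dim:
  assumes "f3_subspace (length es) V" "\<And>p. p \<in> X \<Longrightarrow> f3_fun_vec es p \<in> V"
  shows "f3_fun_rank X es \<le> f3_dim (length es) V"
  unfolding f3_fun_rank_def
  using assms by (intro f3_dim_mono f3_subspace_span_fun_vec f3_span_subset) auto

lemma f3_fun_rank_le_length: "f3_fun_rank X es \<le> length es"
  using f3_fun_rank_le_dim[OF f3_subspace_vecs f3_fun_vec_in_vecs] by (simp add: f3_dim_vecs)

lemma f3_fun_rank_append_le: "f3_fun_rank X (es @ hs) \<le> f3_fun_rank X es + f3_fun_rank X hs"
proof -
  let ?V = "\<lambda>es. f3_span (length es) (f3_fun_vec es ` X)"
  have "f3_fun_rank X (es @ hs) \<le> f3_dim (length (es @ hs)) ((\<lambda>(v, w). v @ w) ` (?V es \<times> ?V hs))"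
    using f3_subspace_append[OF f3_subspace_span_fun_vec f3_subspace_span_fun_vec]
    by (intro f3_fun_rank_le_dim) (auto simp: f3_fun_vec_append f3_fun_vec_in_span)
  also have "\<dots> \<le> f3_fun_rank X es + f3_fun_rank X hs"
    unfolding f3_fun_rank_def length_append
    by (intro f3_dim_append_le f3_subspace_span_fun_vec)
  finally show ?thesis .
qed

lemma f3_fun_rank_mono:
  assumes "set hs \<subseteq> f3_fun_span X (set es)"
  shows "f3_fun_rank X hs \<le> f3_fun_rank X es"
proof -
  let ?m = "length hs" and ?n = "length es"
  let ?V = "f3_span ?n (f3_fun_vec es ` X)"
  have "\<forall>i<?m. \<exists>s. \<forall>p\<in>X. [(hs ! i) p = (\<Sum>j<?n. s j * (es ! j) p)] (mod 3)"
    using assms f3_fun_span_coeffs by (metis nth_mem subsetD)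
  then obtain s where
    s: "\<And>i p. i < ?m \<Longrightarrow> p \<in> X \<Longrightarrow> [(hs ! i) p = (\<Sum>j<?n. s i j * (es ! j) p)] (mod 3)"
    by metis
  have "f3_fun_vec hs p = f3_mat_vec ?m ?n s (f3_fun_vec es p)" if p: "p \<in> X" for p
  proof (rule nth_equalityI)
    fix i assume "i < length (f3_fun_vec hs p)"
    then have i: "i < ?m"
      by (simp add: f3_fun_vec_def)
    have "[(\<Sum>j<?n. s i j * (es ! j) p) = (\<Sum>j<?n. s i j * f3_fun_vec es p ! j)] (mod 3)"
      by (intro cong_sum cong_scalar_left) (simp add: f3_fun_vec_def cong_def)
    then have "[(hs ! i) p = (\<Sum>j<?n. s i j * f3_fun_vec es p ! j)] (mod 3)"
      using s[OF i p] by (rule cong_trans[rotated])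
    then show "f3_fun_vec hs p ! i = f3_mat_vec ?m ?n s (f3_fun_vec es p) ! i"
      using i by (simp add: f3_fun_vec_def f3_mat_vec_def cong_def)
  qed (simp add: f3_fun_vec_def f3_mat_vec_def)
  then have "f3_fun_vec hs p \<in> f3_mat_vec ?m ?n s ` ?V" if "p \<in> X" for p
    using that f3_fun_vec_in_span by (metis imageI)
  then have "f3_fun_rank X hs \<le> f3_dim ?m (f3_mat_vec ?m ?n s ` ?V)"
    by (intro f3_fun_rank_le_dim f3_subspace_mat_vec_image f3_subspace_span_fun_vec)
  also have "\<dots> \<le> f3_fun_rank X es"
    unfolding f3_fun_rank_def by (rule f3_dim_mat_vec_image_le[OF f3_subspace_span_fun_vec])
  finally show ?thesis .
qed

lemma f3_fun_rank_eqI: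
  "set hs \<subseteq> f3_fun_span X (set es) \<Longrightarrow> set es \<subseteq> f3_fun_span X (set hs) \<Longrightarrow>
    f3_fun_rank X hs = f3_fun_rank X es"
  by (simp add: antisym f3_fun_rank_mono)

lemma f3_fun_rank_map_eq_length:
  assumes "distinct is"
    and indep: "\<And>c. (\<And>p. p \<in> X \<Longrightarrow> 3 dvd (\<Sum>i\<in>set is. c i * e i p)) \<Longrightarrow> \<forall>i\<in>set is. 3 dvd c i"
  shows "f3_fun_rank X (map e is) = length is"
proof (rule ccontr)
  let ?n = "length is" and ?V = "f3_span (length is) (f3_fun_vec (map e is) ` X)"
  have V: "f3_subspace ?n ?V"
    using f3_subspace_span_fun_vec[of "map e is" X] by simp
  assume "f3_fun_rank X (map e is) \<noteq> ?n"
  then have "f3_dim ?n ?V < ?n"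
    using f3_fun_rank_le_length[of X "map e is"] by (simp add: f3_fun_rank_def)
  then obtain s :: "nat \<Rightarrow> int" and k where s: "\<And>v. v \<in> ?V \<Longrightarrow> 3 dvd (\<Sum>j<?n. s j * v ! j)"
    and k: "k < ?n" "\<not> 3 dvd s k"
    using f3_annihilator_exists[OF V] by blast
  have bij: "bij_betw ((!) is) {..<?n} (set is)"
    by (rule bij_betw_nth[OF assms(1)]) auto
  define c where "c = (\<lambda>i. s (the_inv_into {..<?n} ((!) is) i))"
  have c_nth: "c (is ! j) = s j" if "j < ?n" for j
    using that bij by (simp add: c_def bij_betw_def the_inv_into_f_f)
  have "3 dvd (\<Sum>i\<in>set is. c i * e i p)" if p: "p \<in> X" for p
  proof -
    have "(\<Sum>i\<in>set is. c i * e i p) = (\<Sum>j<?n. s j * e (is ! j) p)"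
      unfolding sum.reindex_bij_betw[OF bij, symmetric] by (simp add: c_nth)
    also have "[\<dots> = (\<Sum>j<?n. s j * f3_fun_vec (map e is) p ! j)] (mod 3)"
      by (intro cong_sum cong_scalar_left) (simp add: f3_fun_vec_def cong_def)
    finally show ?thesis
      using s[of "f3_fun_vec (map e is) p"] f3_fun_vec_in_span[OF p, of "map e is"]
      by (simp add: cong_dvd_iff)
  qed
  then have "3 dvd c (is ! k)"
    using indep k(1) by (metis nth_mem)
  then show False
    using k by (simp add: c_nth)
qed

subsection \<open>Gray images\<close>

definition word_of :: "('p \<Rightarrow> int) list \<Rightarrow> ('p \<Rightarrow> int) list \<Rightarrow> 'p \<Rightarrow> int list \<times> int list" where
  "word_of \<phi>s \<psi>s p = (map (\<lambda>\<phi>. \<phi> p mod 3) \<phi>s, map (\<lambda>\<psi>. \<psi> p mod 9) \<psi>s)"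

definition div_3 :: "('p \<Rightarrow> int) \<Rightarrow> 'p \<Rightarrow> int" where
  "div_3 \<psi> p = \<psi> p div 3"

definition gray_funs :: "('p \<Rightarrow> int) list \<Rightarrow> ('p \<Rightarrow> int) list" where
  "gray_funs \<psi>s = concat (map (\<lambda>\<psi>. [div_3 \<psi>, \<lambda>p. div_3 \<psi> p + \<psi> p, \<lambda>p. div_3 \<psi> p + 2 * \<psi> p]) \<psi>s)"

lemma length_gray_funs: "length (gray_funs \<psi>s) = 3 * length \<psi>s"
  by (induction \<psi>s) (simp_all add: gray_funs_def)

lemma Gray_word_of: "Gray (word_of \<phi>s \<psi>s p) = f3_fun_vec (\<phi>s @ gray_funs \<psi>s) p"
proof -
  have "gray (t mod 9) = [t div 3 mod 3, (t div 3 + t) mod 3, (t div 3 + 2 * t) mod 3]" for t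
  proof -
    have "t mod 9 div 3 = t div 3 mod 3" "t mod 9 mod 3 = t mod 3"
      using zmod_zmult2_eq[of 3 t 3] by (simp_all add: mod_mod_cancel)
    moreover have "(t div 3 mod 3 + 2 * (t mod 3)) mod 3 = (t div 3 + 2 * t) mod 3"
      using mod_add_cong[OF mod_mod_trivial mod_mult_right_eq] .
    ultimately show ?thesis
      by (simp only: gray_def Let_def mod_add_eq mod_mod_trivial)
  qed
  then have "concat (map (\<lambda>\<psi>. gray (\<psi> p mod 9)) \<psi>s) = f3_fun_vec (gray_funs \<psi>s) p"
    by (induction \<psi>s) (simp_all add: gray_funs_def f3_fun_vec_def div_3_def)
  then show ?thesis
    by (simp add: Gray_def word_of_def f3_fun_vec_def comp_def)
qed

lemma gray_funs_subset_span: "set (gray_funs \<psi>s) \<subseteq> f3_fun_span X (set (\<psi>s @ map div_3 \<psi>s))"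
proof
  let ?D = "f3_fun_span X (set (\<psi>s @ map div_3 \<psi>s))"
  fix e assume "e \<in> set (gray_funs \<psi>s)"
  then obtain \<psi> where "\<psi> \<in> set \<psi>s"
    and e: "e \<in> {div_3 \<psi>, \<lambda>p. div_3 \<psi> p + \<psi> p, \<lambda>p. div_3 \<psi> p + 2 * \<psi> p}"
    by (auto simp: gray_funs_def)
  then have "\<psi> \<in> ?D" "div_3 \<psi> \<in> ?D"
    by (simp_all add: f3_fun_span.base)
  then show "e \<in> ?D"
    using e by (auto intro: f3_fun_span.add f3_fun_span.scale)
qed

lemma digits_subset_span_gray_funs:
  "set (\<psi>s @ map div_3 \<psi>s) \<subseteq> f3_fun_span X (set (gray_funs \<psi>s))"
proof
  let ?G = "f3_fun_span X (set (gray_funs \<psi>s))"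
  fix e assume "e \<in> set (\<psi>s @ map div_3 \<psi>s)"
  then obtain \<psi> where "\<psi> \<in> set \<psi>s" and e: "e = \<psi> \<or> e = div_3 \<psi>"
    by auto
  then have "div_3 \<psi> \<in> ?G" "(\<lambda>p. div_3 \<psi> p + \<psi> p) \<in> ?G"
    by (force simp: gray_funs_def intro: f3_fun_span.base)+
  then show "e \<in> ?G"
    using e f3_fun_span_diff[of "\<lambda>p. div_3 \<psi> p + \<psi> p" X _ "div_3 \<psi>"] by auto
qed

lemma code_rank_word_of:
  "code_rank (length \<phi>s) (length \<psi>s) (word_of \<phi>s \<psi>s ` X) = f3_fun_rank X (\<phi>s @ \<psi>s @ map div_3 \<psi>s)"
proof -
  have span_append: "set (\<phi>s @ es) \<subseteq> f3_fun_span X (set (\<phi>s @ hs))"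
    if "set es \<subseteq> f3_fun_span X (set hs)" for es hs
    using that f3_fun_span_mono[of "set hs" "set (\<phi>s @ hs)" X] by (auto intro: f3_fun_span.base)
  have "code_rank (length \<phi>s) (length \<psi>s) (word_of \<phi>s \<psi>s ` X) = f3_fun_rank X (\<phi>s @ gray_funs \<psi>s)"
    by (simp add: code_rank_def f3_fun_rank_def image_image Gray_word_of length_gray_funs)
  also have "\<dots> = f3_fun_rank X (\<phi>s @ \<psi>s @ map div_3 \<psi>s)"
    by (intro f3_fun_rank_eqI span_append gray_funs_subset_span digits_subset_span_gray_funs)
  finally show ?thesis .
qed

lemma word_of_eqD:
  assumes "word_of \<phi>s \<psi>s p = word_of \<phi>s \<psi>s p'"
  shows "\<phi> \<in> set \<phi>s \<Longrightarrow> \<phi> p mod 3 = \<phi> p' mod 3" "\<psi> \<in> set \<psi>s \<Longrightarrow> \<psi> p mod 9 = \<psi> p' mod 9"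
  using assms by (simp_all add: word_of_def)

definition ternary_coords :: "nat \<Rightarrow> ('p \<Rightarrow> int list \<times> int list) \<Rightarrow> ('p \<Rightarrow> int) list" where
  "ternary_coords a f = map (\<lambda>i p. fst (f p) ! i) [0..<a]"

definition nonary_coords :: "nat \<Rightarrow> ('p \<Rightarrow> int list \<times> int list) \<Rightarrow> ('p \<Rightarrow> int) list" where
  "nonary_coords b f = map (\<lambda>i p. snd (f p) ! i) [0..<b]"

lemma length_coords [simp]: "length (ternary_coords a f) = a" "length (nonary_coords b f) = b"
  by (simp_all add: ternary_coords_def nonary_coords_def)

lemma Z3Z9_space_eq: "Z3Z9_space a b = zmod_vecs 3 a \<times> zmod_vecs 9 b"
proof -
  have "{0..2} = {0..<3::int}" "{0..8} = {0..<9::int}"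
    by auto
  then show ?thesis
    by (auto simp: Z3Z9_space_def zmod_vecs_def)
qed

lemma card_Z3Z9_space: "card (Z3Z9_space a b) = 3 ^ (a + 2 * b)"
  by (simp add: Z3Z9_space_eq card_cartesian_product card_zmod_vecs power_add power_mult)

lemma word_of_coords:
  assumes "f p \<in> Z3Z9_space a b"
  shows "word_of (ternary_coords a f) (nonary_coords b f) p = f p"
  using assms
  by (cases "f p") (auto simp: word_of_def ternary_coords_def nonary_coords_def Z3Z9_space_eq
      zmod_vecs_iff_nth intro!: nth_equalityI)

lemma code_rank_image:
  assumes "f ` X \<subseteq> Z3Z9_space a b"
  shows "code_rank a b (f ` X)
    = f3_fun_rank X (ternary_coords a f @ nonary_coords b f @ map div_3 (nonary_coords b f))"
proof -
  have "f ` X = word_of (ternary_coords a f) (nonary_coords b f) ` X"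
    using assms by (intro image_cong) (auto simp: word_of_coords)
  then show ?thesis
    using code_rank_word_of[of "ternary_coords a f" "nonary_coords b f" X] by simp
qed

lemma inj_on_Gray: "inj_on Gray (Z3Z9_space a b)"
proof (rule inj_onI)
  have inj: "inj_on gray {0..<9}"
  proof (rule inj_on_inverseI[where g = "\<lambda>ts. 3 * ts ! 0 + (ts ! 1 - ts ! 0) mod 3"])
    fix t :: int assume "t \<in> {0..<9}"
    then have "t div 3 mod 3 = t div 3"
      by (intro mod_pos_pos_trivial) auto
    then show "3 * gray t ! 0 + (gray t ! 1 - gray t ! 0) mod 3 = t"
      by (simp add: gray_def Let_def mod_diff_left_eq)
  qed
  fix u v assume uv: "u \<in> Z3Z9_space a b" "v \<in> Z3Z9_space a b" and eq: "Gray u = Gray v"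
  obtain x y x' y' where u: "u = (x, y)" and v: "v = (x', y')"
    by (cases u, cases v)
  have len: "length x = length x'" "length y = length y'"
    and set: "set y \<subseteq> {0..<9}" "set y' \<subseteq> {0..<9}"
    using uv by (simp_all add: u v Z3Z9_space_eq zmod_vecs_def)
  have "x = x'" and "concat (map gray y) = concat (map gray y')"
    using eq len by (simp_all add: Gray_def u v)
  moreover from this(2) have "map gray y = map gray y'"
    using len by (intro concat_injective) (auto simp: gray_def Let_def set_zip)
  then have "y = y'"
    using map_inj_on inj_on_subset[OF inj] set by (metis Un_least)
  ultimately show "u = v"
    by (simp add: u v)
qed

lemma card_le_code_rank:
  assumes C: "C \<subseteq> Z3Z9_space a b"
  shows "card C \<le> 3 ^ code_rank a b C"
proof -
  have "Gray u \<in> f3_vecs (a + 3 * b)" if "u \<in> Z3Z9_space a b" for u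
    using Gray_word_of[of "ternary_coords a id" "nonary_coords b id" u]
      f3_fun_vec_in_vecs[of "ternary_coords a id @ gray_funs (nonary_coords b id)" u]
      word_of_coords[of id u a b] that
    by (simp add: length_gray_funs)
  then have sub: "Gray ` C \<subseteq> f3_vecs (a + 3 * b)"
    using C by auto
  note V = f3_subspace_span[OF sub]
  have "card C = card (Gray ` C)"
    using inj_on_subset[OF inj_on_Gray C] by (simp add: card_image)
  also have "\<dots> \<le> card (f3_span (a + 3 * b) (Gray ` C))"
    by (intro card_mono finite_f3_subspace[OF V] f3_span_superset[OF sub])
  also have "\<dots> = 3 ^ code_rank a b C"
    by (simp add: code_rank_def card_f3_subspace[OF V])
  finally show ?thesis .
qed

subsection \<open>Additive maps\<close>

definition zmod_additive :: "int \<Rightarrow> int \<Rightarrow> nat \<Rightarrow> (int list \<Rightarrow> int) \<Rightarrow> bool" where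
  "zmod_additive m q n \<phi> \<longleftrightarrow>
     (\<forall>v\<in>zmod_vecs q n. \<forall>w\<in>zmod_vecs q n. [\<phi> (zmod_add q v w) = \<phi> v + \<phi> w] (mod m))"

lemma zmod_additiveD:
  "zmod_additive m q n \<phi> \<Longrightarrow> v \<in> zmod_vecs q n \<Longrightarrow> w \<in> zmod_vecs q n \<Longrightarrow>
    [\<phi> (zmod_add q v w) = \<phi> v + \<phi> w] (mod m)"
  by (simp add: zmod_additive_def)

lemma zmod_additive_zero:
  assumes "zmod_additive m q n \<phi>" "0 < q"
  shows "[\<phi> (replicate n 0) = 0] (mod m)"
  using zmod_additiveD[OF assms(1), of "replicate n 0" "replicate n 0"] assms(2)
  by (simp add: replicate_zero_in_zmod_vecs zmod_add_zero_left cong_iff_dvd_diff)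

lemma zmod_additive_tail:
  assumes \<phi>: "zmod_additive m q (Suc n) \<phi>" and "0 < q"
  shows "zmod_additive m q n (\<lambda>v. \<phi> (0 # v))"
  unfolding zmod_additive_def
proof (intro ballI)
  fix v w assume "v \<in> zmod_vecs q n" "w \<in> zmod_vecs q n"
  then show "[\<phi> (0 # zmod_add q v w) = \<phi> (0 # v) + \<phi> (0 # w)] (mod m)"
    using zmod_additiveD[OF \<phi>, of "0 # v" "0 # w"] assms(2)
    by (simp add: Cons_in_zmod_vecs_iff zmod_add_Cons)
qed

lemma zmod_additive_head:
  fixes \<phi> :: "int list \<Rightarrow> int"
  assumes \<phi>: "zmod_additive m q (Suc n) \<phi>" and q: "1 < q"
  shows "[\<phi> ((int s mod q) # replicate n 0) = int s * \<phi> (1 # replicate n 0)] (mod m)"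
proof (induction s)
  case 0
  then show ?case
    using zmod_additive_zero[OF \<phi>] q by simp
next
  case (Suc s)
  let ?z = "replicate n (0::int)"
  have z: "?z \<in> zmod_vecs q n"
    using q by (simp add: replicate_zero_in_zmod_vecs)
  have "zmod_add q (1 # ?z) ((int s mod q) # ?z) = (int (Suc s) mod q) # ?z"
    using z by (simp add: zmod_add_Cons zmod_add_zero_left mod_add_right_eq)
  moreover have "1 # ?z \<in> zmod_vecs q (Suc n)" "(int s mod q) # ?z \<in> zmod_vecs q (Suc n)"
    using q z by (simp_all add: Cons_in_zmod_vecs_iff)
  ultimately have "[\<phi> ((int (Suc s) mod q) # ?z) = \<phi> (1 # ?z) + \<phi> ((int s mod q) # ?z)] (mod m)"
    using zmod_additiveD[OF \<phi>] by metis
  also have "[\<phi> (1 # ?z) + \<phi> ((int s mod q) # ?z) = \<phi> (1 # ?z) + int s * \<phi> (1 # ?z)] (mod m)"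
    by (intro cong_add cong_refl Suc.IH)
  finally show ?case
    by (simp add: algebra_simps)
qed

lemma zmod_additive_linear:
  fixes \<phi> :: "int list \<Rightarrow> int"
  assumes "zmod_additive m q n \<phi>" and q: "1 < q"
  shows "\<exists>A. (\<forall>v\<in>zmod_vecs q n. [\<phi> v = (\<Sum>i<n. A i * v ! i)] (mod m)) \<and>
    (\<forall>i<n. [q * A i = 0] (mod m))"
  using assms(1)
proof (induction n arbitrary: \<phi>)
  case 0
  then show ?case
    using zmod_additive_zero[OF "0.prems"] q by (simp add: zmod_vecs_def)
next
  case (Suc n)
  let ?z = "replicate n (0::int)"
  have z: "?z \<in> zmod_vecs q n"
    using q by (simp add: replicate_zero_in_zmod_vecs)
  have "zmod_additive m q n (\<lambda>v. \<phi> (0 # v))"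
    using zmod_additive_tail[OF Suc.prems] q by simp
  from Suc.IH[OF this]
  obtain A where A: "\<And>v. v \<in> zmod_vecs q n \<Longrightarrow> [\<phi> (0 # v) = (\<Sum>i<n. A i * v ! i)] (mod m)"
    and qA: "\<And>i. i < n \<Longrightarrow> [q * A i = 0] (mod m)"
    by blast
  define A0 where "A0 = \<phi> (1 # ?z)"
  note head = zmod_additive_head[OF Suc.prems q, folded A0_def]
  have "[q * A0 = 0] (mod m)"
    using cong_trans[OF cong_sym[OF head[of "nat q"]]] zmod_additive_zero[OF Suc.prems] q by simp
  moreover have "[\<phi> v = (\<Sum>i<Suc n. case_nat A0 A i * v ! i)] (mod m)"
    if v: "v \<in> zmod_vecs q (Suc n)" for v
  proof -
    obtain s w where v_eq: "v = s # w" and s: "0 \<le> s" "s < q" and w: "w \<in> zmod_vecs q n"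
      using v by (cases v) (auto simp: zmod_vecs_def)
    then have "[\<phi> v = \<phi> (s # ?z) + \<phi> (0 # w)] (mod m)"
      using zmod_additiveD[OF Suc.prems, of "s # ?z" "0 # w"] z
      by (simp add: Cons_in_zmod_vecs_iff zmod_add_Cons zmod_add_zero_left)
    also have "[\<phi> (s # ?z) + \<phi> (0 # w) = s * A0 + (\<Sum>i<n. A i * w ! i)] (mod m)"
      using head[of "nat s"] A[OF w] s by (intro cong_add) simp_all
    finally show ?thesis
      by (simp add: v_eq sum.lessThan_Suc_shift mult.commute del: sum.lessThan_Suc)
  qed
  ultimately show ?case
    using qA by (intro exI[of _ "case_nat A0 A"]) (auto split: nat.split)
qed

lemma z39_add_Pair: "z39_add (x, y) (x', y') = (zmod_add 3 x x', zmod_add 9 y y')"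
  by (simp add: z39_add_def zmod_add_def)

lemma fst_z39_add: "fst (z39_add u v) = zmod_add 3 (fst u) (fst v)"
  and snd_z39_add: "snd (z39_add u v) = zmod_add 9 (snd u) (snd v)"
  by (simp_all add: z39_add_def zmod_add_def)

lemma z39_add_in_space:
  "u \<in> Z3Z9_space a b \<Longrightarrow> v \<in> Z3Z9_space a b \<Longrightarrow> z39_add u v \<in> Z3Z9_space a b"
  by (cases u, cases v) (simp add: z39_add_Pair Z3Z9_space_eq zmod_add_in_vecs)

lemma z39_zero_in_space: "z39_zero a b \<in> Z3Z9_space a b"
  by (simp add: z39_zero_def Z3Z9_space_eq replicate_zero_in_zmod_vecs)

lemma z39_add_zero_left: "u \<in> Z3Z9_space a b \<Longrightarrow> z39_add (z39_zero a b) u = u"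
  by (cases u) (auto simp: z39_zero_def z39_add_Pair Z3Z9_space_eq zmod_add_zero_left)

lemma z39_neg_in_space: "u \<in> Z3Z9_space a b \<Longrightarrow> z39_neg u \<in> Z3Z9_space a b"
  by (cases u) (simp add: z39_neg_def Z3Z9_space_eq zmod_vecs_iff_nth)

lemma z39_add_neg_left: "u \<in> Z3Z9_space a b \<Longrightarrow> z39_add (z39_neg u) u = z39_zero a b"
  by (cases u) (auto simp: z39_zero_def z39_neg_def z39_add_Pair Z3Z9_space_eq zmod_vecs_iff_nth
      mod_simps intro!: nth_equalityI)

lemma z39_triple_eq_zero_iff:
  assumes "(x, y) \<in> Z3Z9_space a b"
  shows "z39_add (x, y) (z39_add (x, y) (x, y)) = z39_zero a b \<longleftrightarrow> (\<forall>t\<in>set y. 3 dvd t)"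
proof -
  have len: "length x = a" "length y = b"
    using assms by (auto simp: Z3Z9_space_eq length_zmod_vecs)
  have "zmod_add 3 x (zmod_add 3 x x) = replicate a 0"
    using len by (intro nth_equalityI) (auto simp: mod_simps)
  moreover have "zmod_add 9 y (zmod_add 9 y y) = replicate b 0 \<longleftrightarrow> (\<forall>i<b. (3 * y ! i) mod 9 = 0)"
    using len by (auto simp: list_eq_iff_nth_eq mod_simps)
  moreover have "(3 * t) mod 9 = 0 \<longleftrightarrow> 3 dvd t" for t :: int
    by presburger
  ultimately show ?thesis
    using len by (simp add: z39_add_Pair z39_zero_def all_set_conv_all_nth)
qed

definition z39_additive :: "int \<Rightarrow> nat \<Rightarrow> nat \<Rightarrow> (int list \<times> int list \<Rightarrow> int) \<Rightarrow> bool" where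
  "z39_additive m g d \<chi> \<longleftrightarrow> (\<forall>u\<in>Z3Z9_space g d. \<forall>v\<in>Z3Z9_space g d.
     [\<chi> (z39_add u v) = \<chi> u + \<chi> v] (mod m))"

lemma z39_additiveD:
  "z39_additive m g d \<chi> \<Longrightarrow> u \<in> Z3Z9_space g d \<Longrightarrow> v \<in> Z3Z9_space g d \<Longrightarrow>
    [\<chi> (z39_add u v) = \<chi> u + \<chi> v] (mod m)"
  by (simp add: z39_additive_def)

lemma z39_additive_zero:
  assumes "z39_additive m g d \<chi>"
  shows "[\<chi> (z39_zero g d) = 0] (mod m)"
  using z39_additiveD[OF assms z39_zero_in_space z39_zero_in_space]
  by (simp add: z39_add_zero_left[OF z39_zero_in_space] cong_iff_dvd_diff)

lemma z39_additive_neg: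
  assumes \<chi>: "z39_additive m g d \<chi>" and u: "u \<in> Z3Z9_space g d"
  shows "[\<chi> (z39_neg u) = - \<chi> u] (mod m)"
proof -
  have "[\<chi> (z39_zero g d) = \<chi> (z39_neg u) + \<chi> u] (mod m)"
    using z39_additiveD[OF \<chi> z39_neg_in_space[OF u] u] by (simp add: z39_add_neg_left[OF u])
  from cong_trans[OF cong_sym[OF this] z39_additive_zero[OF \<chi>]] show ?thesis
    by (simp add: cong_iff_dvd_diff)
qed

lemma z39_additive_linear:
  assumes \<chi>: "z39_additive m g d \<chi>"
  obtains A B where "\<And>u. u \<in> Z3Z9_space g d \<Longrightarrow>
      [\<chi> u = (\<Sum>i<g. A i * fst u ! i) + (\<Sum>j<d. B j * snd u ! j)] (mod m)"
    and "\<And>i. i < g \<Longrightarrow> [3 * A i = 0] (mod m)"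
proof -
  let ?zg = "replicate g (0::int)" and ?zd = "replicate d (0::int)"
  have z: "?zg \<in> zmod_vecs 3 g" "?zd \<in> zmod_vecs 9 d"
    by (simp_all add: replicate_zero_in_zmod_vecs)
  note add = z39_additiveD[OF \<chi>, unfolded Z3Z9_space_eq, OF SigmaI SigmaI, unfolded z39_add_Pair]
  have "zmod_additive m 3 g (\<lambda>x. \<chi> (x, ?zd))" "zmod_additive m 9 d (\<lambda>y. \<chi> (?zg, y))"
    unfolding zmod_additive_def
    using add[OF _ z(2) _ z(2)] add[OF z(1) _ z(1)] z by (simp_all add: zmod_add_zero_left)
  from this[THEN zmod_additive_linear]
  obtain A B where A: "\<forall>x\<in>zmod_vecs 3 g. [\<chi> (x, ?zd) = (\<Sum>i<g. A i * x ! i)] (mod m)"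
    and A3: "\<forall>i<g. [3 * A i = 0] (mod m)"
    and B: "\<forall>y\<in>zmod_vecs 9 d. [\<chi> (?zg, y) = (\<Sum>j<d. B j * y ! j)] (mod m)"
    by auto
  have "[\<chi> (x, y) = (\<Sum>i<g. A i * x ! i) + (\<Sum>j<d. B j * y ! j)] (mod m)"
    if xy: "x \<in> zmod_vecs 3 g" "y \<in> zmod_vecs 9 d" for x y
  proof -
    have "zmod_add 3 x ?zg = x"
      using xy by (intro nth_equalityI) (auto simp: zmod_vecs_iff_nth)
    then have "[\<chi> (x, y) = \<chi> (x, ?zd) + \<chi> (?zg, y)] (mod m)"
      using add[OF xy(1) z(2) z(1) xy(2)] by (simp add: zmod_add_zero_left[OF xy(2)])
    also have "[\<chi> (x, ?zd) + \<chi> (?zg, y) = (\<Sum>i<g. A i * x ! i) + (\<Sum>j<d. B j * y ! j)] (mod m)"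
      using A B xy by (intro cong_add) simp_all
    finally show ?thesis .
  qed
  then have "[\<chi> u = (\<Sum>i<g. A i * fst u ! i) + (\<Sum>j<d. B j * snd u ! j)] (mod m)"
    if "u \<in> Z3Z9_space g d" for u
    using that by (cases u) (simp add: Z3Z9_space_eq)
  then show ?thesis
    using A3[rule_format] by (rule that)
qed

definition torsion_projection :: "nat \<Rightarrow> nat \<Rightarrow> (int list \<times> int list) set \<Rightarrow> int list set" where
  "torsion_projection a b C =
     {x. \<exists>y. (x, y) \<in> C \<and> z39_add (x, y) (z39_add (x, y) (x, y)) = z39_zero a b}"

locale z39_hom =
  fixes a b g d :: nat and f :: "int list \<times> int list \<Rightarrow> int list \<times> int list"
  assumes in_space: "u \<in> Z3Z9_space g d \<Longrightarrow> f u \<in> Z3Z9_space a b"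
    and hom: "u \<in> Z3Z9_space g d \<Longrightarrow> v \<in> Z3Z9_space g d \<Longrightarrow> f (z39_add u v) = z39_add (f u) (f v)"
begin

lemma fst_nth:
  assumes "u \<in> Z3Z9_space g d" "i < a"
  shows "0 \<le> fst (f u) ! i" "fst (f u) ! i < 3"
  using in_space[OF assms(1)] assms(2) by (cases "f u"; simp add: Z3Z9_space_eq zmod_vecs_iff_nth)+

lemma snd_nth:
  assumes "u \<in> Z3Z9_space g d" "i < b"
  shows "0 \<le> snd (f u) ! i" "snd (f u) ! i < 9"
  using in_space[OF assms(1)] assms(2) by (cases "f u"; simp add: Z3Z9_space_eq zmod_vecs_iff_nth)+

lemma length_image:
  assumes "u \<in> Z3Z9_space g d"
  shows "length (fst (f u)) = a" "length (snd (f u)) = b"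
  using in_space[OF assms] by (auto simp: Z3Z9_space_eq length_zmod_vecs mem_Times_iff)

lemma additive_fst: "i < a \<Longrightarrow> z39_additive 3 g d (\<lambda>u. fst (f u) ! i)"
  by (simp add: z39_additive_def hom fst_z39_add snd_z39_add length_image cong_def)

lemma additive_snd: "i < b \<Longrightarrow> z39_additive 9 g d (\<lambda>u. snd (f u) ! i)"
  by (simp add: z39_additive_def hom fst_z39_add snd_z39_add length_image cong_def)

lemma image_zero: "f (z39_zero g d) = z39_zero a b"
proof -
  have z: "z39_zero g d \<in> Z3Z9_space g d"
    by (rule z39_zero_in_space)
  have "fst (f (z39_zero g d)) = replicate a 0"
    using length_image[OF z] fst_nth[OF z] z39_additive_zero[OF additive_fst]
    by (intro nth_equalityI) (simp_all add: cong_def)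
  moreover have "snd (f (z39_zero g d)) = replicate b 0"
    using length_image[OF z] snd_nth[OF z] z39_additive_zero[OF additive_snd]
    by (intro nth_equalityI) (simp_all add: cong_def)
  ultimately show ?thesis
    by (simp add: z39_zero_def prod_eq_iff)
qed

lemma image_neg:
  assumes u: "u \<in> Z3Z9_space g d"
  shows "f (z39_neg u) = z39_neg (f u)"
proof -
  note n = z39_neg_in_space[OF u]
  have "fst (f (z39_neg u)) = fst (z39_neg (f u))"
    using length_image[OF u] length_image[OF n] fst_nth[OF n] z39_additive_neg[OF additive_fst u]
    by (intro nth_equalityI) (simp_all add: z39_neg_def cong_def)
  moreover have "snd (f (z39_neg u)) = snd (z39_neg (f u))"
    using length_image[OF u] length_image[OF n] snd_nth[OF n] z39_additive_neg[OF additive_snd u]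
    by (intro nth_equalityI) (simp_all add: z39_neg_def cong_def)
  ultimately show ?thesis
    by (simp add: prod_eq_iff)
qed

lemma additive_code_image: "additive_code a b (f ` Z3Z9_space g d)"
  unfolding additive_code_def
proof (intro conjI ballI)
  show "f ` Z3Z9_space g d \<subseteq> Z3Z9_space a b"
    using in_space by blast
  show "z39_zero a b \<in> f ` Z3Z9_space g d"
    using image_zero z39_zero_in_space by (metis imageI)
  fix w assume "w \<in> f ` Z3Z9_space g d"
  then obtain u where u: "u \<in> Z3Z9_space g d" "w = f u"
    by blast
  then show "z39_neg w \<in> f ` Z3Z9_space g d"
    using image_neg z39_neg_in_space by (metis imageI)
  fix w' assume "w' \<in> f ` Z3Z9_space g d"
  then obtain u' where "u' \<in> Z3Z9_space g d" "w' = f u'"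
    by blast
  then show "z39_add w w' \<in> f ` Z3Z9_space g d"
    using u hom z39_add_in_space by (metis imageI)
qed

lemma fst_image_cong:
  assumes i: "i < a"
  obtains B where "\<And>u. u \<in> Z3Z9_space g d \<Longrightarrow>
    [fst (f u) ! i = fst (f (fst u, replicate d 0)) ! i + (\<Sum>j<d. B j * snd u ! j)] (mod 3)"
proof -
  obtain A B where lin: "\<And>u. u \<in> Z3Z9_space g d \<Longrightarrow>
      [fst (f u) ! i = (\<Sum>l<g. A l * fst u ! l) + (\<Sum>j<d. B j * snd u ! j)] (mod 3)"
    by (rule z39_additive_linear[OF additive_fst[OF i]]) blast
  have "[fst (f u) ! i = fst (f (fst u, replicate d 0)) ! i + (\<Sum>j<d. B j * snd u ! j)] (mod 3)"
    if u: "u \<in> Z3Z9_space g d" for u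
  proof -
    have "(fst u, replicate d 0) \<in> Z3Z9_space g d"
      using u by (auto simp: Z3Z9_space_eq replicate_zero_in_zmod_vecs)
    from lin[OF this] have "[fst (f (fst u, replicate d 0)) ! i = (\<Sum>l<g. A l * fst u ! l)] (mod 3)"
      by simp
    then show ?thesis
      by (rule cong_trans[OF lin[OF u] cong_add[OF cong_sym cong_refl]])
  qed
  then show ?thesis
    by (rule that)
qed

lemma fst_image_eq_if_torsion:
  assumes xy: "(x, y) \<in> Z3Z9_space g d" and y: "\<And>j. j < d \<Longrightarrow> 3 dvd y ! j"
  shows "fst (f (x, y)) = fst (f (x, replicate d 0))"
proof (rule nth_equalityI)
  have x0: "(x, replicate d 0) \<in> Z3Z9_space g d"
    using xy by (simp add: Z3Z9_space_eq replicate_zero_in_zmod_vecs)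
  show "length (fst (f (x, y))) = length (fst (f (x, replicate d 0)))"
    using xy x0 by (simp add: length_image)
  fix i assume "i < length (fst (f (x, y)))"
  then have i: "i < a"
    using xy by (simp add: length_image)
  obtain B where B: "\<And>u. u \<in> Z3Z9_space g d \<Longrightarrow>
      [fst (f u) ! i = fst (f (fst u, replicate d 0)) ! i + (\<Sum>j<d. B j * snd u ! j)] (mod 3)"
    by (rule fst_image_cong[OF i]) blast
  have "[(\<Sum>j<d. B j * y ! j) = 0] (mod 3)"
    using y by (auto simp: cong_0_iff intro: dvd_sum)
  from cong_trans[OF B[OF xy] cong_add[OF cong_refl]] this
  have "[fst (f (x, y)) ! i = fst (f (x, replicate d 0)) ! i] (mod 3)"
    by fastforce
  then show "fst (f (x, y)) ! i = fst (f (x, replicate d 0)) ! i"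
    using fst_nth[OF xy i] fst_nth[OF x0 i] by (simp add: cong_def)
qed

lemma triple_image_eq_zero_iff:
  assumes inj: "inj_on f (Z3Z9_space g d)" and u: "u \<in> Z3Z9_space g d"
  shows "z39_add (f u) (z39_add (f u) (f u)) = z39_zero a b \<longleftrightarrow> (\<forall>t\<in>set (snd u). 3 dvd t)"
proof -
  have "z39_add (f u) (z39_add (f u) (f u)) = f (z39_add u (z39_add u u))"
    using u by (simp add: hom z39_add_in_space)
  then have "z39_add (f u) (z39_add (f u) (f u)) = z39_zero a b \<longleftrightarrow>
      z39_add u (z39_add u u) = z39_zero g d"
    using inj_on_eq_iff[OF inj] image_zero u by (metis z39_add_in_space z39_zero_in_space)
  then show ?thesis
    using z39_triple_eq_zero_iff[of "fst u" "snd u" g d] u by simp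
qed

lemma torsion_projection_image:
  assumes inj: "inj_on f (Z3Z9_space g d)"
  shows "torsion_projection a b (f ` Z3Z9_space g d) = (\<lambda>x. fst (f (x, replicate d 0))) ` f3_vecs g"
proof (intro equalityI subsetI)
  fix v assume "v \<in> torsion_projection a b (f ` Z3Z9_space g d)"
  then obtain w where "(v, w) \<in> f ` Z3Z9_space g d"
    and w: "z39_add (v, w) (z39_add (v, w) (v, w)) = z39_zero a b"
    unfolding torsion_projection_def by blast
  then obtain u where u: "u \<in> Z3Z9_space g d" "f u = (v, w)"
    by (metis imageE)
  obtain x y where "u = (x, y)"
    by (cases u)
  with u w have xy: "(x, y) \<in> Z3Z9_space g d" "v = fst (f (x, y))"
    and "z39_add (f (x, y)) (z39_add (f (x, y)) (f (x, y))) = z39_zero a b"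
    by auto
  then have "\<And>j. j < d \<Longrightarrow> 3 dvd y ! j"
    using triple_image_eq_zero_iff[OF inj xy(1)] by (auto simp: Z3Z9_space_eq length_zmod_vecs)
  then show "v \<in> (\<lambda>x. fst (f (x, replicate d 0))) ` f3_vecs g"
    using fst_image_eq_if_torsion[OF xy(1)] xy by (auto simp: Z3Z9_space_eq)
next
  fix v assume "v \<in> (\<lambda>x. fst (f (x, replicate d 0))) ` f3_vecs g"
  then obtain x where x: "x \<in> f3_vecs g" "v = fst (f (x, replicate d 0))"
    by blast
  then have u: "(x, replicate d 0) \<in> Z3Z9_space g d"
    by (simp add: Z3Z9_space_eq replicate_zero_in_zmod_vecs)
  then show "v \<in> torsion_projection a b (f ` Z3Z9_space g d)"
    unfolding torsion_projection_def mem_Collect_eq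
    using triple_image_eq_zero_iff[OF inj u] x(2)
    by (intro exI[of _ "snd (f (x, replicate d 0))"]) auto
qed

end

subsection \<open>High digits of linear forms\<close>

lemma div_3_third_difference:
  fixes s t u :: int
  shows "[(s + t + u) div 3 - (s + t) div 3 - (s + u) div 3 - (t + u) div 3
    + s div 3 + t div 3 + u div 3 = s * t * u] (mod 3)"
proof -
  define q r q' r' q'' r'' where qr: "q = s div 3" "r = s mod 3" "q' = t div 3" "r' = t mod 3"
    "q'' = u div 3" "r'' = u mod 3"
  have s: "s = r + q * 3" and t: "t = r' + q' * 3" and u: "u = r'' + q'' * 3"
    by (simp_all add: qr)
  have r: "r \<in> {0, 1, 2}" "r' \<in> {0, 1, 2}" "r'' \<in> {0, 1, 2}"
    by (auto simp: qr)
  have div: "n div 3 = m div 3 + l" if "n = m + l * 3" for n m l :: int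
    using that by simp
  have "(s + t + u) div 3 = (r + r' + r'') div 3 + (q + q' + q'')"
    "(s + t) div 3 = (r + r') div 3 + (q + q')" "(s + u) div 3 = (r + r'') div 3 + (q + q'')"
    "(t + u) div 3 = (r' + r'') div 3 + (q' + q'')"
    by (rule div; simp only: s t u algebra_simps)+
  then have "(s + t + u) div 3 - (s + t) div 3 - (s + u) div 3 - (t + u) div 3 + q + q' + q''
      = (r + r' + r'') div 3 - (r + r') div 3 - (r + r'') div 3 - (r' + r'') div 3"
    by linarith
  also have "[(r + r' + r'') div 3 - (r + r') div 3 - (r + r'') div 3 - (r' + r'') div 3
      = r * r' * r''] (mod 3)"
    using r by (auto simp: cong_def)
  also have "[r * r' * r'' = s * t * u] (mod 3)"
    unfolding qr by (intro cong_mult cong_mod_leftI cong_refl)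
  finally show ?thesis
    by (simp add: qr)
qed

lemma div_3_fourth_difference:
  fixes s t u v :: int
  shows "[(s + t + u + v) div 3 = (s + t + u) div 3 + (s + t + v) div 3 + (s + u + v) div 3
    + (t + u + v) div 3 - (s + t) div 3 - (s + u) div 3 - (s + v) div 3 - (t + u) div 3
    - (t + v) div 3 - (u + v) div 3 + s div 3 + t div 3 + u div 3 + v div 3] (mod 3)"
proof -
  let ?T = "\<lambda>s t u. (s + t + u) div 3 - (s + t) div 3 - (s + u) div 3 - (t + u) div 3
    + s div 3 + t div 3 + u div 3 :: int"
  have "[?T s t (u + v) = s * t * u + s * t * v] (mod 3)"
    using div_3_third_difference[of s t "u + v"] by (simp add: distrib_left)
  also have "[s * t * u + s * t * v = ?T s t u + ?T s t v] (mod 3)"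
    by (intro cong_add cong_sym[OF div_3_third_difference])
  finally show ?thesis
    by (simp add: cong_iff_dvd_diff algebra_simps)
qed

definition mset_form :: "nat multiset \<Rightarrow> int list \<times> int list \<Rightarrow> int" where
  "mset_form M u = (\<Sum>j\<in>#M. snd u ! j)"

lemma mset_form_simps [simp]:
  "mset_form {#} u = 0"
  "mset_form (add_mset i M) u = snd u ! i + mset_form M u"
  by (simp_all add: mset_form_def)

lemma mset_form_add: "mset_form (M + N) u = mset_form M u + mset_form N u"
  by (simp add: mset_form_def)

lemma mset_form_sum: "mset_form (\<Sum>j\<in>J. M j) u = (\<Sum>j\<in>J. mset_form (M j) u)"
  by (induction J rule: infinite_finite_induct) (simp_all add: mset_form_add)

lemma mset_form_replicate: "mset_form (replicate_mset n i) u = int n * snd u ! i"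
  by (induction n) (simp_all add: algebra_simps)

lemma mset_form_zero: "set_mset M \<subseteq> {..<d} \<Longrightarrow> mset_form M (x, replicate d 0) = 0"
  by (induction M) auto

definition short_multisets :: "nat \<Rightarrow> nat multiset set" where
  "short_multisets d = (\<Union>n\<in>{1, 2, 3}. multisets_of_size {..<d} n)"

lemma short_multisets_iff:
  "M \<in> short_multisets d \<longleftrightarrow> set_mset M \<subseteq> {..<d} \<and> M \<noteq> {#} \<and> size M \<le> 3"
proof -
  have "size M \<in> {1, 2, 3} \<longleftrightarrow> M \<noteq> {#} \<and> size M \<le> 3"
    using nonempty_has_size[of M] by auto
  then show ?thesis
    by (auto simp: short_multisets_def multisets_of_size_def)
qed

lemma finite_short_multisets [simp]: "finite (short_multisets d)"
  unfolding short_multisets_def by blast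

lemma card_short_multisets:
  "card (short_multisets d) = d + ((d + 1) choose 2) + ((d + 2) choose 3)"
proof -
  have "card (short_multisets d) = (\<Sum>n\<in>{1, 2, 3}. card (multisets_of_size {..<d} n))"
    unfolding short_multisets_def
    by (intro card_UN_disjoint ballI impI finite_multisets_of_size)
      (auto simp: multisets_of_size_def)
  then show ?thesis
    by (simp add: card_multisets_of_size)
qed

lemma high_digit_add_mset_in_span:
  assumes "R \<noteq> {#}"
    and sub: "\<And>M. M \<subset># {#i, j, k#} + R \<Longrightarrow> div_3 (mset_form M) \<in> f3_fun_span X E"
  shows "div_3 (mset_form ({#i, j, k#} + R)) \<in> f3_fun_span X E"
proof (rule f3_fun_span.cong)
  show "(\<lambda>p. div_3 (mset_form {#i, j, k#}) p + div_3 (mset_form ({#i, j#} + R)) p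
      + div_3 (mset_form ({#i, k#} + R)) p + div_3 (mset_form ({#j, k#} + R)) p
      - div_3 (mset_form {#i, j#}) p - div_3 (mset_form {#i, k#}) p
      - div_3 (mset_form ({#i#} + R)) p - div_3 (mset_form {#j, k#}) p
      - div_3 (mset_form ({#j#} + R)) p - div_3 (mset_form ({#k#} + R)) p
      + div_3 (mset_form {#i#}) p + div_3 (mset_form {#j#}) p + div_3 (mset_form {#k#}) p
      + div_3 (mset_form R) p) \<in> f3_fun_span X E" (is "?h \<in> _")
    using assms(1) by (intro f3_fun_span.add f3_fun_span_diff sub) (auto simp: subset_mset_def)
  show "[div_3 (mset_form ({#i, j, k#} + R)) p = ?h p] (mod 3)" for p
    using div_3_fourth_difference[of "snd p ! i" "snd p ! j" "snd p ! k" "mset_form R p"]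
    by (simp add: div_3_def mset_form_add add.assoc)
qed

lemma high_digit_in_span:
  assumes "set_mset N \<subseteq> {..<d}"
    and basis: "\<And>M. M \<in> short_multisets d \<Longrightarrow> div_3 (mset_form M) \<in> f3_fun_span X E"
  shows "div_3 (mset_form N) \<in> f3_fun_span X E"
  using assms(1)
proof (induction "size N" arbitrary: N rule: less_induct)
  case less
  consider (empty) "N = {#}" | (short) "N \<in> short_multisets d" | (long) "3 < size N"
    using less.prems by (auto simp: short_multisets_iff not_le[symmetric])
  then show ?case
  proof cases
    case empty
    then have "div_3 (mset_form N) = (\<lambda>_. 0)"
      by (simp add: fun_eq_iff div_3_def)
    then show ?thesis
      by (simp add: f3_fun_span.zero)
  next
    case short
    then show ?thesis
      by (rule basis)
  next
    case long
    then obtain m where "size N = Suc (3 + m)"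
      using less_imp_Suc_add by blast
    then have "size N = Suc (Suc (Suc (Suc m)))"
      by simp
    then obtain i j k R where N: "N = {#i, j, k#} + R" and "size R = Suc m"
      by (auto elim!: size_mset_SucE)
    then have "R \<noteq> {#}"
      by auto
    moreover have "div_3 (mset_form M) \<in> f3_fun_span X E" if "M \<subset># N" for M
      using that less by (meson mset_subset_size set_mset_mono subset_mset.less_imp_le subset_trans)
    ultimately show ?thesis
      unfolding N by (rule high_digit_add_mset_in_span)
  qed
qed

lemma short_multiset_of_three_indices:
  assumes "N \<in> short_multisets d" "i \<in># N" "j \<in># N" "k \<in># N" "i \<noteq> j" "i \<noteq> k" "j \<noteq> k"
  shows "N = {#i, j, k#}"
proof -
  have "{#i, j, k#} \<subseteq># N"
    using assms(2-7) by (intro mset_subset_eqI) (simp, auto)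
  moreover have "size N \<le> size {#i, j, k#}"
    using assms(1) by (simp add: short_multisets_iff)
  ultimately show ?thesis
    by (metis leD mset_subset_size subset_mset.le_less)
qed

lemma short_multiset_of_two_indices:
  assumes N: "N \<in> short_multisets d" "i \<in># N" "j \<in># N" "i \<noteq> j"
  shows "N \<in> {{#i, j#}, {#i, i, j#}, {#i, j, j#}} \<or> (\<exists>k\<in>#N. k \<noteq> i \<and> k \<noteq> j)"
proof -
  obtain R where R: "N = {#i, j#} + R"
    using N(2-4) by (metis add_mset_add_single insert_noteq_member multi_member_split
        union_mset_add_mset_left add.left_neutral)
  then have "size R \<le> 1"
    using N(1) by (simp add: short_multisets_iff)
  then consider "R = {#}" | k where "R = {#k#}"
    by (metis One_nat_def le_SucE le_zero_eq size_1_singleton_mset size_eq_0_iff_empty)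
  then show ?thesis
    by cases (auto simp: R add_mset_commute)
qed

lemma short_multiset_of_one_index:
  assumes N: "N \<in> short_multisets d" "i \<in># N"
  shows "N \<in> {{#i#}, {#i, i#}, {#i, i, i#}} \<or> (\<exists>j\<in>#N. j \<noteq> i)"
proof (cases "\<exists>j\<in>#N. j \<noteq> i")
  case False
  then have "N = replicate_mset (size N) i"
    by (metis set_mset_subset_singletonD singletonI subsetI)
  moreover have "size N \<in> {1, 2, 3}"
    using N(1) by (auto simp: short_multisets_def multisets_of_size_def)
  ultimately show ?thesis
    by (metis (no_types, lifting) insert_iff empty_iff numeral_2_eq_2 numeral_3_eq_3 One_nat_def
        replicate_mset_0 replicate_mset_Suc)
qed simp

lemma dvd_sum_subset_iff:
  fixes h :: "'a \<Rightarrow> 'b::comm_ring_1"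
  assumes "finite S" "T \<subseteq> S" "\<And>x. x \<in> S - T \<Longrightarrow> m dvd h x"
  shows "m dvd sum h S \<longleftrightarrow> m dvd sum h T"
proof -
  have "m dvd sum h (S - T)"
    by (rule dvd_sum) (rule assms(3))
  then show ?thesis
    unfolding sum.subset_diff[OF assms(2,1)] by (rule dvd_add_right_iff)
qed

locale high_digit_relation =
  fixes g d :: nat and C :: "nat multiset \<Rightarrow> int"
  assumes relation: "u \<in> Z3Z9_space g d \<Longrightarrow>
    3 dvd (\<Sum>M\<in>short_multisets d. C M * div_3 (mset_form M) u)"
begin

lemma relation_at_three_points:
  assumes "i < d" "j < d" "k < d" and xyz: "0 \<le> x" "0 \<le> y" "0 \<le> z" "x + y + z \<le> 8"
  shows "3 dvd (\<Sum>M\<in>short_multisets d.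
    C M * ((x * int (count M i) + y * int (count M j) + z * int (count M k)) div 3))"
proof -
  let ?w = "map (\<lambda>l. x * of_bool (l = i) + y * of_bool (l = j) + z * of_bool (l = k)) [0..<d]"
  have "mset_form M (replicate g 0, ?w)
      = x * int (count M i) + y * int (count M j) + z * int (count M k)"
    if "set_mset M \<subseteq> {..<d}" for M
    using that by (induction M) (auto simp: algebra_simps)
  then have "(\<Sum>M\<in>short_multisets d. C M * div_3 (mset_form M) (replicate g 0, ?w))
      = (\<Sum>M\<in>short_multisets d.
          C M * ((x * int (count M i) + y * int (count M j) + z * int (count M k)) div 3))"
    by (intro sum.cong) (simp_all add: div_3_def short_multisets_iff)
  moreover have "(replicate g 0, ?w) \<in> Z3Z9_space g d"
    using xyz by (auto simp: Z3Z9_space_eq zmod_vecs_iff_nth of_bool_def)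
  then have "3 dvd (\<Sum>M\<in>short_multisets d. C M * div_3 (mset_form M) (replicate g 0, ?w))"
    by (rule relation)
  ultimately show ?thesis
    by simp
qed

lemma dvd_coeff_of_three_indices:
  assumes M: "M \<in> short_multisets d"
    and ijk: "i \<in># M" "j \<in># M" "k \<in># M" "i \<noteq> j" "i \<noteq> k" "j \<noteq> k"
  shows "3 dvd C M"
proof -
  define q where "q = (\<lambda>x y z N.
    (x * int (count N i) + y * int (count N j) + z * int (count N k)) div 3)"
  define third_diff where "third_diff = (\<lambda>N. q 1 1 1 N - q 1 1 0 N - q 1 0 1 N - q 0 1 1 N
    + q 1 0 0 N + q 0 1 0 N + q 0 0 1 N)"
  have lt: "i < d" "j < d" "k < d"
    using M ijk(1-3) by (auto simp: short_multisets_iff)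
  let ?S = "\<lambda>x y z. \<Sum>N\<in>short_multisets d. C N * q x y z N"
  have "3 dvd ?S 1 1 1 - ?S 1 1 0 - ?S 1 0 1 - ?S 0 1 1 + ?S 1 0 0 + ?S 0 1 0 + ?S 0 0 1"
    unfolding q_def using lt by (intro dvd_add dvd_diff relation_at_three_points) auto
  also have "\<dots> = (\<Sum>N\<in>short_multisets d. C N * third_diff N)"
    by (simp add: third_diff_def sum.distrib sum_subtractf distrib_left right_diff_distrib)
  finally have "3 dvd (\<Sum>N\<in>short_multisets d. C N * third_diff N)" .
  moreover have "3 dvd C N * third_diff N" if N: "N \<in> short_multisets d - {M}" for N
  proof -
    have "\<not> (i \<in># N \<and> j \<in># N \<and> k \<in># N)"
      using N short_multiset_of_three_indices[OF M ijk]
        short_multiset_of_three_indices[of N d i j k] ijk(4-6) by auto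
    then have "count N i = 0 \<or> count N j = 0 \<or> count N k = 0"
      by (simp add: not_in_iff)
    then have "third_diff N = 0"
      by (elim disjE) (simp_all add: third_diff_def q_def)
    then show ?thesis
      by simp
  qed
  ultimately have "3 dvd (\<Sum>N\<in>{M}. C N * third_diff N)"
    using M by (subst (asm) dvd_sum_subset_iff[of _ "{M}"]) auto
  moreover have "third_diff M = 1"
    using ijk(4-6) by (simp add: third_diff_def q_def short_multiset_of_three_indices[OF M ijk])
  ultimately show ?thesis
    by simp
qed

lemma second_difference_relation:
  assumes ij: "i < d" "j < d" "i \<noteq> j" and xy: "0 \<le> x" "0 \<le> y" "x + y \<le> 8"
  shows "3 dvd (\<Sum>N\<in>{{#i, j#}, {#i, i, j#}, {#i, j, j#}}.
    C N * ((x * int (count N i) + y * int (count N j)) div 3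
      - x * int (count N i) div 3 - y * int (count N j) div 3))"
    (is "3 dvd (\<Sum>N\<in>?T. C N * ?E N)")
proof -
  let ?S = "\<lambda>x y. \<Sum>N\<in>short_multisets d.
    C N * ((x * int (count N i) + y * int (count N j) + 0 * int (count N i)) div 3)"
  have "3 dvd ?S x y - ?S x 0 - ?S 0 y"
    using ij xy by (intro dvd_diff relation_at_three_points) auto
  also have "\<dots> = (\<Sum>N\<in>short_multisets d. C N * ?E N)"
    by (simp add: sum_subtractf right_diff_distrib)
  finally have "3 dvd (\<Sum>N\<in>short_multisets d. C N * ?E N)" .
  moreover have "3 dvd C N * ?E N" if N: "N \<in> short_multisets d - ?T" for N
  proof (cases "i \<in># N \<and> j \<in># N")
    case True
    then obtain k where "k \<in># N" "k \<noteq> i" "k \<noteq> j"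
      using N short_multiset_of_two_indices[of N d i j] ij(3) by blast
    then have "3 dvd C N"
      using N True ij(3) by (intro dvd_coeff_of_three_indices[of N i j k]) auto
    then show ?thesis
      by simp
  next
    case False
    then have "count N i = 0 \<or> count N j = 0"
      by (simp add: not_in_iff)
    then show ?thesis
      by (elim disjE) simp_all
  qed
  moreover have "?T \<subseteq> short_multisets d"
    using ij by (auto simp: short_multisets_iff)
  ultimately show ?thesis
    by (simp only: dvd_sum_subset_iff[OF finite_short_multisets])
qed

lemma dvd_coeff_of_two_indices:
  assumes M: "M \<in> short_multisets d" and ij: "i \<in># M" "j \<in># M" "i \<noteq> j"
  shows "3 dvd C M"
proof -
  have lt: "i < d" "j < d"
    using M ij by (auto simp: short_multisets_iff)
  note rel = second_difference_relation[OF lt ij(3)]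
  have "3 dvd C {#i, i, j#} + C {#i, j, j#}" "3 dvd C {#i, j#} + C {#i, i, j#}"
      "3 dvd C {#i, j#} + C {#i, j, j#}"
    using rel[of 1 1] rel[of 1 2] rel[of 2 1] ij(3) by simp_all
  then have "3 dvd C {#i, j#}" "3 dvd C {#i, i, j#}" "3 dvd C {#i, j, j#}"
    by presburger+
  then show ?thesis
    using short_multiset_of_two_indices[OF M ij] dvd_coeff_of_three_indices[OF M ij(1,2) _ ij(3)]
    by blast
qed

lemma first_difference_relation:
  assumes i: "i < d" and x: "0 \<le> x" "x \<le> 8"
  shows "3 dvd C {#i#} * (x div 3) + C {#i, i#} * (2 * x div 3) + C {#i, i, i#} * x"
proof -
  let ?T = "{{#i#}, {#i, i#}, {#i, i, i#}}"
  let ?q = "\<lambda>N. (x * int (count N i) + 0 * int (count N i) + 0 * int (count N i)) div 3"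
  have "3 dvd (\<Sum>N\<in>short_multisets d. C N * ?q N)"
    using i x by (intro relation_at_three_points) auto
  moreover have "3 dvd C N * ?q N" if N: "N \<in> short_multisets d - ?T" for N
  proof (cases "i \<in># N")
    case True
    then have "3 dvd C N"
      using N short_multiset_of_one_index[of N d i] dvd_coeff_of_two_indices by blast
    then show ?thesis
      by simp
  qed (simp add: not_in_iff)
  moreover have "?T \<subseteq> short_multisets d"
    using i by (auto simp: short_multisets_iff)
  ultimately have "3 dvd (\<Sum>N\<in>?T. C N * ?q N)"
    by (simp only: dvd_sum_subset_iff[OF finite_short_multisets])
  then show ?thesis
    by (simp add: add.assoc mult.commute)
qed

lemma dvd_coeff:
  assumes M: "M \<in> short_multisets d"
  shows "3 dvd C M"
proof -
  obtain i where i: "i \<in># M" "i < d"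
    using M by (force simp: short_multisets_iff)
  note rel = first_difference_relation[OF i(2)]
  have "3 dvd C {#i, i, i#}" "3 dvd C {#i, i#} + C {#i, i, i#} * 2"
      "3 dvd C {#i#} + C {#i, i#} * 2 + C {#i, i, i#} * 3"
    using rel[of 1] rel[of 2] rel[of 3] by simp_all
  then have "3 dvd C {#i#}" "3 dvd C {#i, i#}" "3 dvd C {#i, i, i#}"
    by presburger+
  then show ?thesis
    using short_multiset_of_one_index[OF M i(1)] dvd_coeff_of_two_indices[OF M i(1)] by blast
qed

end

subsection \<open>Upper bounds for the rank\<close>

lemma ternary_coord_in_span:
  "i < g \<Longrightarrow> set (ternary_coords g id) \<subseteq> E \<Longrightarrow> (\<lambda>u. fst u ! i) \<in> f3_fun_span X E"
  by (rule f3_fun_span.base) (force simp: ternary_coords_def)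

lemma div_3_mset_form_cube: "div_3 (mset_form {#j, j, j#}) = (\<lambda>u. snd u ! j)"
  by (simp add: fun_eq_iff div_3_def)

lemma div_3_triple: "div_3 (\<lambda>p. 3 * h p) = h"
  by (simp add: fun_eq_iff div_3_def)

lemma nonary_coord_in_span:
  assumes "j < d" and basis: "\<And>M. M \<in> short_multisets d \<Longrightarrow> div_3 (mset_form M) \<in> f3_fun_span X E"
  shows "(\<lambda>u. snd u ! j) \<in> f3_fun_span X E"
  using basis[of "{#j, j, j#}"] assms(1) by (simp add: short_multisets_iff div_3_mset_form_cube)

lemma mset_form_in_span:
  assumes "set_mset N \<subseteq> {..<d}" "\<And>j. j < d \<Longrightarrow> (\<lambda>u. snd u ! j) \<in> f3_fun_span X E"
  shows "mset_form N \<in> f3_fun_span X E"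
  using assms(1)
proof (induction N)
  case empty
  have "mset_form {#} = (\<lambda>_. 0)"
    by (simp add: fun_eq_iff)
  then show ?case
    by (simp add: f3_fun_span.zero)
next
  case (add j N)
  have "mset_form (add_mset j N) = (\<lambda>u. snd u ! j + mset_form N u)"
    by (simp add: fun_eq_iff)
  then show ?case
    using add assms(2) by (simp add: f3_fun_span.add)
qed

context z39_hom
begin

lemma snd_eq_mset_form:
  assumes "i < b"
  obtains A N where "set_mset N \<subseteq> {..<d}"
    and "\<And>u. u \<in> Z3Z9_space g d \<Longrightarrow>
      [snd (f u) ! i = 3 * (\<Sum>l<g. A l * fst u ! l) + mset_form N u] (mod 9)"
proof -
  obtain A B where lin: "\<And>u. u \<in> Z3Z9_space g d \<Longrightarrow>
      [snd (f u) ! i = (\<Sum>l<g. A l * fst u ! l) + (\<Sum>j<d. B j * snd u ! j)] (mod 9)"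
    and A: "\<And>l. l < g \<Longrightarrow> [3 * A l = 0] (mod 9)"
    by (rule z39_additive_linear[OF additive_snd[OF assms]]) blast
  let ?N = "\<Sum>j<d. replicate_mset (nat (B j mod 9)) j"
  have "[snd (f u) ! i = 3 * (\<Sum>l<g. A l div 3 * fst u ! l) + mset_form ?N u] (mod 9)"
    if u: "u \<in> Z3Z9_space g d" for u
  proof -
    have A3: "A l = 3 * (A l div 3)" if "l < g" for l
      using A[OF that] unfolding cong_def by presburger
    have "(\<Sum>l<g. A l * fst u ! l) = (\<Sum>l<g. 3 * (A l div 3) * fst u ! l)"
      using A3 by (intro sum.cong) auto
    then have "(\<Sum>l<g. A l * fst u ! l) = 3 * (\<Sum>l<g. A l div 3 * fst u ! l)"
      by (simp add: sum_distrib_left mult.assoc)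
    moreover have "[(\<Sum>j<d. B j * snd u ! j) = mset_form ?N u] (mod 9)"
      unfolding mset_form_sum mset_form_replicate
      by (intro cong_sum cong_scalar_right) (simp add: cong_def)
    ultimately show ?thesis
      using cong_trans[OF lin[OF u] cong_add[OF cong_refl]] by simp
  qed
  moreover have "set_mset ?N \<subseteq> {..<d}"
    by (auto simp: set_mset_sum)
  ultimately show ?thesis
    by (rule that[rotated])
qed

lemma fst_image_in_span:
  assumes "i < a" "\<And>l. l < g \<Longrightarrow> (\<lambda>u. fst u ! l) \<in> f3_fun_span (Z3Z9_space g d) E"
    and "\<And>j. j < d \<Longrightarrow> (\<lambda>u. snd u ! j) \<in> f3_fun_span (Z3Z9_space g d) E"
  shows "(\<lambda>u. fst (f u) ! i) \<in> f3_fun_span (Z3Z9_space g d) E"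
proof -
  obtain A B where lin: "\<And>u. u \<in> Z3Z9_space g d \<Longrightarrow>
      [fst (f u) ! i = (\<Sum>l<g. A l * fst u ! l) + (\<Sum>j<d. B j * snd u ! j)] (mod 3)"
    by (rule z39_additive_linear[OF additive_fst[OF assms(1)]]) blast
  show ?thesis
    by (rule f3_fun_span.cong[OF _ lin])
      (auto intro!: f3_fun_span.add f3_fun_span_sum f3_fun_span.scale assms(2,3))
qed

lemma snd_image_in_span:
  assumes "i < b" "\<And>j. j < d \<Longrightarrow> (\<lambda>u. snd u ! j) \<in> f3_fun_span (Z3Z9_space g d) E"
  shows "(\<lambda>u. snd (f u) ! i) \<in> f3_fun_span (Z3Z9_space g d) E"
proof -
  obtain A N where N: "set_mset N \<subseteq> {..<d}" and eq: "\<And>u. u \<in> Z3Z9_space g d \<Longrightarrow>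
      [snd (f u) ! i = 3 * (\<Sum>l<g. A l * fst u ! l) + mset_form N u] (mod 9)"
    by (rule snd_eq_mset_form[OF assms(1)]) blast
  show ?thesis
  proof (rule f3_fun_span.cong[OF mset_form_in_span[OF N assms(2)]])
    show "[snd (f u) ! i = mset_form N u] (mod 3)" if "u \<in> Z3Z9_space g d" for u
      using cong_dvd_modulus[OF eq[OF that], of 3] by (simp add: cong_def)
  qed
qed

lemma div_3_snd_image_in_span:
  assumes "i < b" "\<And>l. l < g \<Longrightarrow> (\<lambda>u. fst u ! l) \<in> f3_fun_span (Z3Z9_space g d) E"
    and "\<And>M. M \<in> short_multisets d \<Longrightarrow> div_3 (mset_form M) \<in> f3_fun_span (Z3Z9_space g d) E"
  shows "div_3 (\<lambda>u. snd (f u) ! i) \<in> f3_fun_span (Z3Z9_space g d) E"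
proof -
  obtain A N where N: "set_mset N \<subseteq> {..<d}" and eq: "\<And>u. u \<in> Z3Z9_space g d \<Longrightarrow>
      [snd (f u) ! i = 3 * (\<Sum>l<g. A l * fst u ! l) + mset_form N u] (mod 9)"
    by (rule snd_eq_mset_form[OF assms(1)]) blast
  have "[div_3 (\<lambda>u. snd (f u) ! i) u = (\<Sum>l<g. A l * fst u ! l) + div_3 (mset_form N) u] (mod 3)"
    if u: "u \<in> Z3Z9_space g d" for u
  proof -
    let ?t = "\<Sum>l<g. A l * fst u ! l"
    obtain m where "3 * ?t + mset_form N u = snd (f u) ! i + 9 * m"
      using eq[OF u] by (auto simp: cong_iff_lin)
    then have "snd (f u) ! i = mset_form N u + (?t - 3 * m) * 3"
      by simp
    then have "snd (f u) ! i div 3 = ?t + mset_form N u div 3 - 3 * m"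
      by simp
    then show ?thesis
      by (simp add: div_3_def cong_iff_dvd_diff)
  qed
  then show ?thesis
    by (rule f3_fun_span.cong[rotated])
      (auto intro!: f3_fun_span.add f3_fun_span_sum f3_fun_span.scale assms(2)
        high_digit_in_span[OF N assms(3)])
qed

lemma code_rank_eq:
  "code_rank a b (f ` Z3Z9_space g d) = f3_fun_rank (Z3Z9_space g d)
     (ternary_coords a f @ nonary_coords b f @ map div_3 (nonary_coords b f))"
  using in_space by (intro code_rank_image) blast

lemma code_rank_le_short_multisets:
  "code_rank a b (f ` Z3Z9_space g d) \<le> g + card (short_multisets d)"
proof -
  let ?X = "Z3Z9_space g d"
  obtain Ms where Ms: "set Ms = short_multisets d" "distinct Ms"
    using finite_distinct_list[OF finite_short_multisets] by blast
  define es where "es = ternary_coords g id @ map (\<lambda>M. div_3 (mset_form M)) Ms"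
  have free: "(\<lambda>u. fst u ! l) \<in> f3_fun_span ?X (set es)" if "l < g" for l
    using that by (rule ternary_coord_in_span) (simp add: es_def)
  have high: "div_3 (mset_form M) \<in> f3_fun_span ?X (set es)" if "M \<in> short_multisets d" for M
    using that Ms by (intro f3_fun_span.base) (simp add: es_def)
  note low = nonary_coord_in_span[OF _ high]
  have "code_rank a b (f ` ?X) \<le> f3_fun_rank ?X es"
    unfolding code_rank_eq
    by (intro f3_fun_rank_mono)
      (auto simp: ternary_coords_def nonary_coords_def
        intro!: fst_image_in_span[OF _ free low] snd_image_in_span[OF _ low]
        div_3_snd_image_in_span[OF _ free high])
  also have "\<dots> \<le> length es"
    by (rule f3_fun_rank_le_length)
  also have "\<dots> = g + card (short_multisets d)"
    using Ms distinct_card by (fastforce simp: es_def)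
  finally show ?thesis .
qed

lemma f3_subspace_torsion_projection:
  assumes inj: "inj_on f (Z3Z9_space g d)"
  shows "f3_subspace a (torsion_projection a b (f ` Z3Z9_space g d))"
  unfolding torsion_projection_image[OF inj] f3_subspace_def
proof (intro conjI ballI)
  let ?p = "\<lambda>x. fst (f (x, replicate d 0))"
  have space: "(x, replicate d 0) \<in> Z3Z9_space g d" if "x \<in> f3_vecs g" for x
    using that by (simp add: Z3Z9_space_eq replicate_zero_in_zmod_vecs)
  show "?p ` f3_vecs g \<subseteq> f3_vecs a"
    using in_space[OF space] by (force simp: Z3Z9_space_eq mem_Times_iff)
  have "?p (replicate g 0) = replicate a 0"
    using image_zero by (simp add: z39_zero_def)
  then show "replicate a 0 \<in> ?p ` f3_vecs g"
    using replicate_zero_in_zmod_vecs[of 3 g] by (metis imageI zero_less_numeral)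
  fix v w assume "v \<in> ?p ` f3_vecs g" "w \<in> ?p ` f3_vecs g"
  then obtain x y where xy: "x \<in> f3_vecs g" "y \<in> f3_vecs g" "v = ?p x" "w = ?p y"
    by blast
  have "zmod_add 9 (replicate d 0) (replicate d 0) = replicate d 0"
    by (simp add: zmod_add_zero_left replicate_zero_in_zmod_vecs)
  then have "f3_add v w = ?p (f3_add x y)"
    using hom[OF space[OF xy(1)] space[OF xy(2)]]
    by (simp add: xy fst_z39_add z39_add_Pair f3_add_eq_zmod_add)
  then show "f3_add v w \<in> ?p ` f3_vecs g"
    using f3_add_in_vecs[OF xy(1,2)] by blast
qed

lemma code_rank_le_fun_rank_torsion_part:
  "code_rank a b (f ` Z3Z9_space g d)
    \<le> f3_fun_rank (Z3Z9_space g d) (ternary_coords a (\<lambda>u. f (fst u, replicate d 0))) + d + b"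
proof -
  let ?X = "Z3Z9_space g d"
  define es :: "(int list \<times> int list \<Rightarrow> int) list"
    where "es = ternary_coords a (\<lambda>u. f (fst u, replicate d 0))"
  define hs where "hs = nonary_coords d id @ map div_3 (nonary_coords b f)"
  define E where "E = set (es @ hs)"
  have low: "(\<lambda>u. snd u ! j) \<in> f3_fun_span ?X E" if "j < d" for j
    using that by (intro f3_fun_span.base) (auto simp: E_def hs_def nonary_coords_def)
  have "(\<lambda>u. fst (f u) ! i) \<in> f3_fun_span ?X E" if i: "i < a" for i
  proof -
    obtain B where B: "\<And>u. u \<in> Z3Z9_space g d \<Longrightarrow>
        [fst (f u) ! i = fst (f (fst u, replicate d 0)) ! i + (\<Sum>j<d. B j * snd u ! j)] (mod 3)"
      by (rule fst_image_cong[OF i]) blast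
    have "(\<lambda>u. fst (f (fst u, replicate d 0)) ! i) \<in> f3_fun_span ?X E"
      using i by (intro f3_fun_span.base) (auto simp: E_def es_def ternary_coords_def)
    moreover have "(\<lambda>u. \<Sum>j<d. B j * snd u ! j) \<in> f3_fun_span ?X E"
      by (intro f3_fun_span_sum f3_fun_span.scale low) simp
    ultimately show ?thesis
      by (rule f3_fun_span.cong[OF f3_fun_span.add B])
  qed
  moreover have "div_3 h \<in> f3_fun_span ?X E" if "h \<in> set (nonary_coords b f)" for h
    using that by (intro f3_fun_span.base) (simp add: E_def hs_def)
  ultimately have "set (ternary_coords a f @ nonary_coords b f @ map div_3 (nonary_coords b f))
      \<subseteq> f3_fun_span ?X E"
    by (auto simp: ternary_coords_def nonary_coords_def intro!: snd_image_in_span[OF _ low])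
  then have "code_rank a b (f ` ?X) \<le> f3_fun_rank ?X (es @ hs)"
    unfolding code_rank_eq E_def by (rule f3_fun_rank_mono)
  also have "\<dots> \<le> f3_fun_rank ?X es + f3_fun_rank ?X hs"
    by (rule f3_fun_rank_append_le)
  also have "f3_fun_rank ?X hs \<le> d + b"
    using f3_fun_rank_le_length[of ?X hs] by (simp add: hs_def)
  finally show ?thesis
    by (simp add: es_def)
qed

lemma fun_rank_torsion_part_le_dim:
  assumes inj: "inj_on f (Z3Z9_space g d)"
  shows "f3_fun_rank (Z3Z9_space g d) (ternary_coords a (\<lambda>u. f (fst u, replicate d 0)))
    \<le> f3_dim a (torsion_projection a b (f ` Z3Z9_space g d))"
proof -
  let ?X = "Z3Z9_space g d" and ?es = "ternary_coords a (\<lambda>u. f (fst u, replicate d 0))"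
  have "f3_fun_vec ?es u \<in> torsion_projection a b (f ` ?X)" if u: "u \<in> ?X" for u
  proof -
    have u0: "(fst u, replicate d 0) \<in> ?X" and "fst u \<in> f3_vecs g"
      using u by (auto simp: Z3Z9_space_eq replicate_zero_in_zmod_vecs)
    moreover have "f3_fun_vec ?es u = fst (f (fst u, replicate d 0))"
      using length_image[OF u0] fst_nth[OF u0]
      by (intro nth_equalityI) (simp_all add: f3_fun_vec_def ternary_coords_def)
    ultimately show ?thesis
      unfolding torsion_projection_image[OF inj] by blast
  qed
  then show ?thesis
    using f3_fun_rank_le_dim[of ?es "torsion_projection a b (f ` ?X)" ?X]
      f3_subspace_torsion_projection[OF inj] by simp
qed

lemma code_rank_le_length:
  assumes "inj_on f (Z3Z9_space g d)"
  shows "code_rank a b (f ` Z3Z9_space g d)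
    \<le> f3_dim a (torsion_projection a b (f ` Z3Z9_space g d)) + d + b"
  using code_rank_le_fun_rank_torsion_part fun_rank_torsion_part_le_dim[OF assms] by linarith

end

lemma code_type_iff_hom:
  "code_type a b g d k C \<longleftrightarrow> (\<exists>f. z39_hom a b g d f \<and> inj_on f (Z3Z9_space g d) \<and>
     C = f ` Z3Z9_space g d \<and> f3_dim a (torsion_projection a b C) = k)"
proof
  assume "code_type a b g d k C"
  then obtain f where "C \<subseteq> Z3Z9_space a b" "bij_betw f (Z3Z9_space g d) C"
    and "\<forall>u\<in>Z3Z9_space g d. \<forall>v\<in>Z3Z9_space g d. f (z39_add u v) = z39_add (f u) (f v)"
    and "f3_dim a (torsion_projection a b C) = k"
    unfolding code_type_def additive_code_def torsion_projection_def by blast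
  then show "\<exists>f. z39_hom a b g d f \<and> inj_on f (Z3Z9_space g d) \<and>
     C = f ` Z3Z9_space g d \<and> f3_dim a (torsion_projection a b C) = k"
    by (intro exI[of _ f]) (auto simp: z39_hom_def bij_betw_def)
next
  assume "\<exists>f. z39_hom a b g d f \<and> inj_on f (Z3Z9_space g d) \<and>
     C = f ` Z3Z9_space g d \<and> f3_dim a (torsion_projection a b C) = k"
  then obtain f where f: "z39_hom a b g d f" "inj_on f (Z3Z9_space g d)" "C = f ` Z3Z9_space g d"
    and "f3_dim a (torsion_projection a b C) = k"
    by blast
  then show "code_type a b g d k C"
    unfolding code_type_def torsion_projection_def
    using z39_hom.additive_code_image[OF f(1)] z39_hom.hom[OF f(1)]
    by (auto simp: bij_betw_def)
qed

lemma code_rank_bounds: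
  assumes "code_type a b g d k C"
  shows "code_rank a b C
    \<in> {g + 2 * d .. min (b + d + k) (g + d + ((d + 1) choose 2) + ((d + 2) choose 3))}"
proof -
  obtain f where f: "z39_hom a b g d f" "inj_on f (Z3Z9_space g d)" "C = f ` Z3Z9_space g d"
    and k: "f3_dim a (torsion_projection a b C) = k"
    using assms unfolding code_type_iff_hom by blast
  interpret z39_hom a b g d f
    by (fact f(1))
  have "C \<subseteq> Z3Z9_space a b"
    using in_space f(3) by blast
  then have "card C \<le> 3 ^ code_rank a b C"
    by (rule card_le_code_rank)
  moreover have "card C = 3 ^ (g + 2 * d)"
    using f(2,3) by (simp add: card_image card_Z3Z9_space)
  ultimately have "g + 2 * d \<le> code_rank a b C"
    by simp
  then show ?thesis
    using code_rank_le_length[OF f(2)] code_rank_le_short_multisets k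
    by (simp add: f(3) card_short_multisets)
qed

subsection \<open>Codes of prescribed rank\<close>

lemma dvd_coeffs_of_message_relation:
  assumes Ms: "set Ms \<subseteq> short_multisets d"
    and rel: "\<And>u. u \<in> Z3Z9_space g d \<Longrightarrow>
      3 dvd (\<Sum>i<g. B i * fst u ! i) + (\<Sum>M\<in>set Ms. C M * div_3 (mset_form M) u)"
  shows "i < g \<Longrightarrow> 3 dvd B i" "M \<in> set Ms \<Longrightarrow> 3 dvd C M"
proof -
  show free: "3 dvd B i" if i: "i < g" for i
  proof -
    let ?u = "((replicate g 0)[i := 1], replicate d 0) :: int list \<times> int list"
    have "?u \<in> Z3Z9_space g d"
      using i by (auto simp: Z3Z9_space_eq zmod_vecs_iff_nth nth_list_update)
    note rel[OF this]
    moreover have "(\<Sum>l<g. B l * fst ?u ! l) = (\<Sum>l<g. if l = i then B l else 0)"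
      by (intro sum.cong) (auto simp: nth_list_update)
    moreover have "(\<Sum>M\<in>set Ms. C M * div_3 (mset_form M) ?u) = 0"
      using Ms by (intro sum.neutral) (auto simp: div_3_def mset_form_zero short_multisets_iff)
    ultimately show ?thesis
      using i by simp
  qed
  interpret high_digit_relation g d "\<lambda>M. if M \<in> set Ms then C M else 0"
  proof
    fix u assume u: "u \<in> Z3Z9_space g d"
    have "3 dvd (\<Sum>i<g. B i * fst u ! i)"
      using free by (intro dvd_sum) simp
    then have "3 dvd (\<Sum>M\<in>set Ms. C M * div_3 (mset_form M) u)"
      using rel[OF u] by (simp add: dvd_add_right_iff)
    also have "\<dots> = (\<Sum>M\<in>short_multisets d. (if M \<in> set Ms then C M else 0) * div_3 (mset_form M) u)"
      using Ms by (intro sum.mono_neutral_cong_left) auto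
    finally show "3 dvd \<dots>" .
  qed
  show "3 dvd C M" if "M \<in> set Ms"
    using dvd_coeff[of M] that Ms by auto
qed

lemma f3_fun_rank_message_basis:
  assumes "distinct Ms" and Ms: "set Ms \<subseteq> short_multisets d"
  shows "f3_fun_rank (Z3Z9_space g d)
    (ternary_coords g id @ map (\<lambda>M. div_3 (mset_form M)) Ms) = g + length Ms"
proof -
  let ?X = "Z3Z9_space g d"
  define e where "e = case_sum (\<lambda>i u. fst u ! i) (\<lambda>M. div_3 (mset_form M))"
  let ?is = "map Inl [0..<g] @ map Inr Ms"
  have set_is: "set ?is = {..<g} <+> set Ms"
    by auto
  have "ternary_coords g id @ map (\<lambda>M. div_3 (mset_form M)) Ms = map e ?is"
    by (simp add: e_def ternary_coords_def)
  also have "f3_fun_rank ?X (map e ?is) = length ?is"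
  proof (rule f3_fun_rank_map_eq_length)
    show "distinct ?is"
      using assms(1) by (auto simp: distinct_map)
    fix c assume "\<And>u. u \<in> ?X \<Longrightarrow> 3 dvd (\<Sum>i\<in>set ?is. c i * e i u)"
    then have "3 dvd (\<Sum>i<g. c (Inl i) * fst u ! i) + (\<Sum>M\<in>set Ms. c (Inr M) * div_3 (mset_form M) u)"
      if "u \<in> ?X" for u
      using that unfolding set_is by (simp add: sum.Plus e_def)
    note dvd_coeffs_of_message_relation[OF Ms this]
    then show "\<forall>i\<in>set ?is. 3 dvd c i"
      by auto
  qed
  finally show ?thesis
    by simp
qed

lemma z39_hom_word_of:
  assumes "\<And>\<phi>. \<phi> \<in> set \<phi>s \<Longrightarrow> z39_additive 3 g d \<phi>" "\<And>\<psi>. \<psi> \<in> set \<psi>s \<Longrightarrow> z39_additive 9 g d \<psi>"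
  shows "z39_hom (length \<phi>s) (length \<psi>s) g d (word_of \<phi>s \<psi>s)"
proof
  show "word_of \<phi>s \<psi>s u \<in> Z3Z9_space (length \<phi>s) (length \<psi>s)" for u
    by (simp add: word_of_def Z3Z9_space_eq zmod_vecs_iff_nth)
  show "word_of \<phi>s \<psi>s (z39_add u v) = z39_add (word_of \<phi>s \<psi>s u) (word_of \<phi>s \<psi>s v)"
    if uv: "u \<in> Z3Z9_space g d" "v \<in> Z3Z9_space g d" for u v
    using assms[THEN z39_additiveD, OF _ uv]
    by (auto simp: word_of_def z39_add_Pair cong_def mod_add_eq intro!: nth_equalityI)
qed

lemma z39_additive_ternary_coord: "i < g \<Longrightarrow> z39_additive 3 g d (\<lambda>u. fst u ! i)"
  by (auto simp: z39_additive_def fst_z39_add Z3Z9_space_eq length_zmod_vecs cong_def)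

lemma z39_additive_triple_ternary_coord:
  assumes "i < g"
  shows "z39_additive 9 g d (\<lambda>u. 3 * fst u ! i)"
  unfolding z39_additive_def
proof (intro ballI)
  fix u v assume uv: "u \<in> Z3Z9_space g d" "v \<in> Z3Z9_space g d"
  have "3 * fst (z39_add u v) ! i = (3 * (fst u ! i + fst v ! i)) mod 9"
    using uv assms by (auto simp: fst_z39_add Z3Z9_space_eq length_zmod_vecs mult_mod_right)
  then show "[3 * fst (z39_add u v) ! i = 3 * fst u ! i + 3 * fst v ! i] (mod 9)"
    by (simp add: cong_def)
qed

lemma z39_additive_mset_form:
  assumes "set_mset M \<subseteq> {..<d}"
  shows "z39_additive 9 g d (mset_form M)"
  unfolding z39_additive_def
proof (intro ballI)
  fix u v assume uv: "u \<in> Z3Z9_space g d" "v \<in> Z3Z9_space g d"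
  show "[mset_form M (z39_add u v) = mset_form M u + mset_form M v] (mod 9)"
    using assms
  proof (induction M)
    case (add j M)
    then have "[snd (z39_add u v) ! j = snd u ! j + snd v ! j] (mod 9)"
      using uv by (auto simp: snd_z39_add Z3Z9_space_eq length_zmod_vecs cong_def)
    moreover have "[mset_form M (z39_add u v) = mset_form M u + mset_form M v] (mod 9)"
      using add by simp
    ultimately have "[snd (z39_add u v) ! j + mset_form M (z39_add u v)
        = snd u ! j + snd v ! j + (mset_form M u + mset_form M v)] (mod 9)"
      by (rule cong_add)
    then show ?case
      by (simp add: algebra_simps)
  qed simp
qed

lemma inj_cube: "inj (\<lambda>j. {#j, j, j#})"
  by (rule injI) (auto dest: arg_cong[of _ _ set_mset])

locale prescribed_rank_code =
  fixes a b g d k :: nat and Ms :: "nat multiset list"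
  assumes k_le: "k \<le> a" "k \<le> g"
    and distinct_Ms: "distinct Ms" and Ms_short: "set Ms \<subseteq> short_multisets d"
    and singleton_in_Ms: "j < d \<Longrightarrow> {#j#} \<in> set Ms"
    and cube_notin_Ms: "{#j, j, j#} \<notin> set Ms"
    and length_le: "length Ms + (g - k) \<le> b"
begin

definition ternary_functionals :: "(int list \<times> int list \<Rightarrow> int) list" where
  "ternary_functionals = ternary_coords k id @ replicate (a - k) (\<lambda>_. 0)"

definition nonary_functionals :: "(int list \<times> int list \<Rightarrow> int) list" where
  "nonary_functionals = map mset_form Ms @ map (\<lambda>i u. 3 * fst u ! i) [k..<g]
     @ replicate (b - (length Ms + (g - k))) (\<lambda>_. 0)"

abbreviation enc where "enc \<equiv> word_of ternary_functionals nonary_functionals"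

abbreviation messages where "messages \<equiv> Z3Z9_space g d"

lemma length_ternary_functionals: "length ternary_functionals = a"
  and length_nonary_functionals: "length nonary_functionals = b"
  using k_le length_le by (simp_all add: ternary_functionals_def nonary_functionals_def)

lemma set_mset_subset: "M \<in> set Ms \<Longrightarrow> set_mset M \<subseteq> {..<d}"
  using subsetD[OF Ms_short] by (simp add: short_multisets_iff)

lemma ternary_coord_in_functionals: "i < k \<Longrightarrow> (\<lambda>u. fst u ! i) \<in> set ternary_functionals"
  by (simp add: ternary_functionals_def ternary_coords_def)

lemma mset_form_in_functionals: "M \<in> set Ms \<Longrightarrow> mset_form M \<in> set nonary_functionals"
  by (simp add: nonary_functionals_def)

lemma triple_ternary_coord_in_functionals:
  "k \<le> i \<Longrightarrow> i < g \<Longrightarrow> (\<lambda>u. 3 * fst u ! i) \<in> set nonary_functionals"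
  by (simp add: nonary_functionals_def)

lemma ternary_functionals_cases:
  assumes "\<phi> \<in> set ternary_functionals"
  obtains i where "i < k" "\<phi> = (\<lambda>u. fst u ! i)" | "\<phi> = (\<lambda>_. 0)"
  using assms by (auto simp: ternary_functionals_def ternary_coords_def)

lemma nonary_functionals_cases:
  assumes "\<psi> \<in> set nonary_functionals"
  obtains M where "M \<in> set Ms" "\<psi> = mset_form M"
    | i where "i < g" "\<psi> = (\<lambda>u. 3 * fst u ! i)" | "\<psi> = (\<lambda>_. 0)"
  using assms by (auto simp: nonary_functionals_def)

sublocale enc: z39_hom a b g d enc
proof -
  have zero: "z39_additive m g d (\<lambda>_. 0)" for m
    by (simp add: z39_additive_def)
  have "z39_additive 3 g d \<phi>" if "\<phi> \<in> set ternary_functionals" for \<phi>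
    using that k_le(2) zero
    by (cases rule: ternary_functionals_cases) (simp_all add: z39_additive_ternary_coord)
  moreover have "z39_additive 9 g d \<psi>" if "\<psi> \<in> set nonary_functionals" for \<psi>
    using that zero
    by (cases rule: nonary_functionals_cases)
      (simp_all add: z39_additive_mset_form set_mset_subset z39_additive_triple_ternary_coord)
  ultimately show "z39_hom a b g d enc"
    using z39_hom_word_of[of ternary_functionals g d nonary_functionals]
    by (simp add: length_ternary_functionals length_nonary_functionals)
qed

lemma fst_eq_of_enc_eq:
  assumes uv: "u \<in> messages" "v \<in> messages" and eq: "enc u = enc v"
  shows "fst u = fst v"
proof (rule nth_equalityI)
  show "length (fst u) = length (fst v)"
    using uv by (auto simp: Z3Z9_space_eq length_zmod_vecs)
  fix i assume "i < length (fst u)"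
  then have i: "i < g" and bounds: "0 \<le> fst u ! i" "fst u ! i < 3" "0 \<le> fst v ! i" "fst v ! i < 3"
    using uv by (auto simp: Z3Z9_space_eq zmod_vecs_iff_nth)
  show "fst u ! i = fst v ! i"
  proof (cases "i < k")
    case True
    then show ?thesis
      using word_of_eqD(1)[OF eq ternary_coord_in_functionals, of i] bounds by simp
  next
    case False
    then show ?thesis
      using word_of_eqD(2)[OF eq triple_ternary_coord_in_functionals, of i] i bounds by simp
  qed
qed

lemma snd_eq_of_enc_eq:
  assumes uv: "u \<in> messages" "v \<in> messages" and eq: "enc u = enc v"
  shows "snd u = snd v"
proof (rule nth_equalityI)
  show "length (snd u) = length (snd v)"
    using uv by (auto simp: Z3Z9_space_eq length_zmod_vecs)
  fix j assume "j < length (snd u)"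
  then have j: "j < d" and "0 \<le> snd u ! j" "snd u ! j < 9" "0 \<le> snd v ! j" "snd v ! j < 9"
    using uv by (auto simp: Z3Z9_space_eq zmod_vecs_iff_nth)
  then show "snd u ! j = snd v ! j"
    using word_of_eqD(2)[OF eq mset_form_in_functionals[OF singleton_in_Ms[OF j]]] by simp
qed

lemma inj_on_enc: "inj_on enc messages"
  by (rule inj_onI, rule prod_eqI) (rule fst_eq_of_enc_eq snd_eq_of_enc_eq; assumption)+

lemma torsion_projection_code:
  "torsion_projection a b (enc ` messages) = (\<lambda>v. v @ replicate (a - k) 0) ` f3_vecs k"
proof -
  have "fst (enc (x, y)) = take k x @ replicate (a - k) 0" if "x \<in> f3_vecs g" for x y
  proof -
    have "map (\<lambda>i. x ! i mod 3) [0..<k] = take k x"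
      using that k_le(2) by (intro nth_equalityI) (auto simp: zmod_vecs_iff_nth)
    then show ?thesis
      by (simp add: word_of_def ternary_functionals_def ternary_coords_def comp_def
          map_replicate_const)
  qed
  then have "torsion_projection a b (enc ` messages)
      = (\<lambda>v. v @ replicate (a - k) 0) ` take k ` f3_vecs g"
    unfolding enc.torsion_projection_image[OF inj_on_enc] image_image by simp
  also have "take k ` f3_vecs g = f3_vecs k"
  proof (intro equalityI subsetI)
    fix v assume "v \<in> f3_vecs k"
    then have "take k (v @ replicate (g - k) 0) = v" "v @ replicate (g - k) 0 \<in> f3_vecs g"
      using k_le(2) append_in_zmod_vecs[of v 3 k "replicate (g - k) 0" "g - k"]
      by (simp_all add: length_zmod_vecs replicate_zero_in_zmod_vecs)
    then show "v \<in> take k ` f3_vecs g"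
      by (metis imageI)
  qed (use k_le(2) in \<open>auto simp: zmod_vecs_iff_nth\<close>)
  finally show ?thesis .
qed

lemma code_type_enc: "code_type a b g d k (enc ` messages)"
proof -
  have "card (torsion_projection a b (enc ` messages)) = 3 ^ k"
    unfolding torsion_projection_code by (simp add: card_image inj_on_def card_zmod_vecs)
  then have "f3_dim a (torsion_projection a b (enc ` messages)) = k"
    using card_f3_subspace[OF enc.f3_subspace_torsion_projection[OF inj_on_enc]] by simp
  then show ?thesis
    unfolding code_type_iff_hom using enc.z39_hom_axioms inj_on_enc by blast
qed

definition digits :: "(int list \<times> int list \<Rightarrow> int) list" where
  "digits = ternary_functionals @ nonary_functionals @ map div_3 nonary_functionals"

definition basis_multisets :: "nat multiset list" where
  "basis_multisets = map (\<lambda>j. {#j, j, j#}) [0..<d] @ Ms"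

definition digit_basis :: "(int list \<times> int list \<Rightarrow> int) list" where
  "digit_basis = ternary_coords g id @ map (\<lambda>M. div_3 (mset_form M)) basis_multisets"

lemma digits_subset_span: "set digits \<subseteq> f3_fun_span messages (set digit_basis)"
proof -
  let ?E = "f3_fun_span messages (set digit_basis)"
  have zero: "(\<lambda>_. 0) \<in> ?E" "div_3 (\<lambda>_. 0) \<in> ?E"
    by (simp_all add: f3_fun_span.zero div_3_def[abs_def])
  have free: "(\<lambda>u. fst u ! i) \<in> ?E" if "i < g" for i
    using that by (rule ternary_coord_in_span) (simp add: digit_basis_def)
  have low: "(\<lambda>u. snd u ! j) \<in> ?E" if "j < d" for j
    using that
    by (intro f3_fun_span.base)
      (auto simp: digit_basis_def basis_multisets_def div_3_mset_form_cube)
  have form: "mset_form M \<in> ?E" "div_3 (mset_form M) \<in> ?E" if "M \<in> set Ms" for M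
    using that mset_form_in_span[OF set_mset_subset low]
    by (auto simp: digit_basis_def basis_multisets_def intro: f3_fun_span.base)
  have "\<phi> \<in> ?E" if "\<phi> \<in> set ternary_functionals" for \<phi>
    using that k_le(2) by (cases rule: ternary_functionals_cases) (simp_all add: free zero)
  moreover have "\<psi> \<in> ?E \<and> div_3 \<psi> \<in> ?E" if "\<psi> \<in> set nonary_functionals" for \<psi>
    using that
    by (cases rule: nonary_functionals_cases)
      (simp_all add: form free zero div_3_triple f3_fun_span.scale)
  ultimately show ?thesis
    by (auto simp: digits_def)
qed

lemma digit_basis_subset_digits: "set digit_basis \<subseteq> set digits"
proof -
  have "(\<lambda>u. fst u ! i) \<in> set digits" if i: "i < g" for i
  proof (cases "i < k")
    case False
    then have "div_3 (\<lambda>u. 3 * fst u ! i) \<in> set digits"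
      using triple_ternary_coord_in_functionals[of i] i by (simp add: digits_def)
    then show ?thesis
      by (simp add: div_3_triple)
  qed (simp add: digits_def ternary_coord_in_functionals)
  moreover have "(\<lambda>u. snd u ! j) \<in> set digits" if "j < d" for j
    using mset_form_in_functionals[OF singleton_in_Ms[OF that]]
    by (simp add: digits_def mset_form_def[abs_def])
  moreover have "div_3 (mset_form M) \<in> set digits" if "M \<in> set Ms" for M
    using mset_form_in_functionals[OF that] by (simp add: digits_def)
  ultimately show ?thesis
    by (auto simp: digit_basis_def basis_multisets_def ternary_coords_def div_3_mset_form_cube)
qed

lemma code_rank_enc: "code_rank a b (enc ` messages) = g + d + length Ms"
proof -
  have "code_rank a b (enc ` messages) = f3_fun_rank messages digits"
    using code_rank_word_of[of ternary_functionals nonary_functionals messages]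
    by (simp add: length_ternary_functionals length_nonary_functionals digits_def)
  also have "\<dots> = f3_fun_rank messages digit_basis"
    using digits_subset_span digit_basis_subset_digits
    by (intro f3_fun_rank_eqI) (auto intro: f3_fun_span.base)
  also have "\<dots> = g + length basis_multisets"
    unfolding digit_basis_def
  proof (rule f3_fun_rank_message_basis)
    show "distinct basis_multisets"
      using distinct_Ms cube_notin_Ms inj_on_subset[OF inj_cube]
      by (auto simp: basis_multisets_def distinct_map)
    show "set basis_multisets \<subseteq> short_multisets d"
      using Ms_short by (auto simp: basis_multisets_def short_multisets_iff)
  qed
  finally show ?thesis
    by (simp add: basis_multisets_def)
qed

end

lemma code_of_rank_exists:
  assumes "k \<le> min a g"
    and r: "r \<in> {g + 2 * d .. min (b + d + k) (g + d + ((d + 1) choose 2) + ((d + 2) choose 3))}"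
  shows "\<exists>C. code_type a b g d k C \<and> code_rank a b C = r"
proof -
  let ?cubes = "(\<lambda>j. {#j, j, j#}) ` {..<d}" and ?singletons = "(\<lambda>j. {#j#}) ` {..<d}"
  have "card ?cubes = d" "card ?singletons = d"
    using card_image[OF inj_on_subset[OF inj_cube], of "{..<d}"]
    by (simp_all add: card_image inj_on_def)
  moreover have "card (short_multisets d - ?cubes) = card (short_multisets d) - card ?cubes"
    by (intro card_Diff_subset) (auto simp: short_multisets_iff)
  moreover have "?singletons \<subseteq> short_multisets d - ?cubes"
    by (auto simp: short_multisets_iff)
  moreover have "d \<le> r - (g + d)" "r - (g + d) \<le> card (short_multisets d) - d"
    using r by (auto simp: card_short_multisets)
  ultimately obtain S
    where S: "?singletons \<subseteq> S" "S \<subseteq> short_multisets d - ?cubes" "card S = r - (g + d)"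
    using exists_subset_between[of ?singletons "r - (g + d)" "short_multisets d - ?cubes"] by auto
  have "finite S"
    using finite_subset[OF S(2)] by simp
  then obtain Ms where Ms: "set Ms = S" "distinct Ms"
    using finite_distinct_list by blast
  have length_Ms: "length Ms = r - (g + d)"
    using Ms S(3) distinct_card by fastforce
  interpret prescribed_rank_code a b g d k Ms
  proof
    show "{#j, j, j#} \<notin> set Ms" for j
      using S(2) Ms(1) by (auto simp: short_multisets_iff)
    show "length Ms + (g - k) \<le> b"
      using assms by (auto simp: length_Ms)
  qed (use assms(1) S Ms in auto)
  have "code_rank a b (enc ` messages) = r"
    using code_rank_enc r by (simp add: length_Ms)
  then show ?thesis
    using code_type_enc by blast
qed

theorem theorem6:
  fixes a b g d k r :: nat
  assumes "0 < a" "0 < b" "0 < g" "0 < d" "0 < k"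
    and "0 < g + d" "g + d \<le> b + k" "k \<le> min a g"
  shows "(\<exists>C. additive_code a b C \<and> code_type a b g d k C \<and> code_rank a b C = r) \<longleftrightarrow>
         r \<in> {g + 2 * d .. min (b + d + k) (g + d + ((d + 1) choose 2) + ((d + 2) choose 3))}"
proof
  assume "\<exists>C. additive_code a b C \<and> code_type a b g d k C \<and> code_rank a b C = r"
  then show "r \<in> {g + 2 * d .. min (b + d + k) (g + d + ((d + 1) choose 2) + ((d + 2) choose 3))}"
    using code_rank_bounds by blast
next
  assume "r \<in> {g + 2 * d .. min (b + d + k) (g + d + ((d + 1) choose 2) + ((d + 2) choose 3))}"
  then obtain C where "code_type a b g d k C" "code_rank a b C = r"
    using code_of_rank_exists[OF assms(8)] by blast
  then show "\<exists>C. additive_code a b C \<and> code_type a b g d k C \<and> code_rank a b C = r"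
    by (auto simp: code_type_def)
qed

end
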